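(* Fix $H\in(\tfrac12,1)$, $\sigma>0$ and a continuous $a:[0,1]\to\mathbb{R}$. For any sequence of integers $N_n\geq n$, $$\lim_{n\to\infty}\frac{|\mathcal{A}_n^{(N_n,H)}|}{2^{n-1}}=P(|\mathcal{Y}_H|>g_H)>0.$$ In particular, $$\lim_{N\to\infty}\frac{|\mathcal{A}^{(N,H)}|}{2^N-1}=P(|\mathcal{Y}_H|>g_H).$$
   Context: Let $c_H=\sqrt{\frac{2H\,\Gamma(\frac32-H)}{\Gamma(H+\frac12)\Gamma(2-2H)}}$, $C_H=c_H(H-\frac12)$ and $k_H(t,s)=C_H\, s^{\frac12-H}\int_s^t u^{H-\frac12}(u-s)^{H-\frac32}\,du$. For integers $N>1$, $1\le i<n\le N$, set $J_n^{(N,H)}(i)=\sigma\sqrt N\int_{(i-1)/N}^{i/N}\big(k_H(\tfrac nN,u)-k_H(\tfrac{n-1}N,u)\big)du$, and for $1\le n\le N$ set $g_n^{(N,H)}=\sigma\sqrt N\int_{(n-1)/N}^{n/N}k_H(\tfrac nN,u)\,du$ and $a_n^{(N)}=\frac1N a(n/N)$. For $x\in\{-1,1\}^{n-1}$ let $Y_n^{(N,H)}(x)=\sum_{i=1}^{n-1}J_n^{(N,H)}(i)x_i$ (with $Y_1^{(N,H)}=0$), $u_n^{(N)}(x)=Y_n^{(N,H)}(x)+g_n^{(N,H)}$, $d_n^{(N)}(x)=Y_n^{(N,H)}(x)-g_n^{(N,H)}$. The $N$-binary tree is $\mathbb{X}_N=\{\tau\}\cup\bigcup_{n=1}^{N-1}\{-1,1\}^n$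 (so $|\mathbb{X}_N|=2^N-1$). For $n\ge2$, $\mathcal{A}_n^{(N,H)}=\{x\in\{-1,1\}^{n-1}: u_n^{(N)}(x)\le -a_n^{(N)}\text{ or } d_n^{(N)}(x)\ge -a_n^{(N)}\}$; $\mathcal{A}_1^{(N,H)}=\{\tau\}$ if $u_1^{(N)}\le -a_1^{(N)}$ or $d_1^{(N)}\ge -a_1^{(N)}$, and $\emptyset$ otherwise; $\mathcal{A}^{(N,H)}=\bigcup_{n=1}^N\mathcal{A}_n^{(N,H)}$. Let $(\xi_k)_{k\ge1}$ be i.i.d. with $P(\xi_k=1)=P(\xi_k=-1)=\frac12$, $h=\frac H2+\frac14$, $\rho_h(k)=\frac12\big((k+1)^{2h}+(k-1)^{2h}-2k^{2h}\big)$, $g_H=\frac{\sigma c_H}{H+\frac12}$, and $\mathcal{Y}_H=2g_H\sum_{k=1}^\infty\rho_h(k)\xi_k$ (the series converges almost surely). *)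

theory Defs
  imports "HOL-Probability.Probability"
begin

definition cH :: "real \<Rightarrow> real" where
  "cH H = sqrt (2 * H * Gamma (3/2 - H) / (Gamma (H + 1/2) * Gamma (2 - 2*H)))"

definition CH :: "real \<Rightarrow> real" where
  "CH H = cH H * (H - 1/2)"

definition kH :: "real \<Rightarrow> real \<Rightarrow> real \<Rightarrow> real" where
  "kH H t s = CH H * s powr (1/2 - H) *
     (LINT u:{s..t}|lborel. u powr (H - 1/2) * (u - s) powr (H - 3/2))"

definition Jn :: "real \<Rightarrow> real \<Rightarrow> nat \<Rightarrow> nat \<Rightarrow> nat \<Rightarrow> real" where
  "Jn H \<sigma> N n i = \<sigma> * sqrt (real N) *
     (LINT u:{(real i - 1) / real N .. real i / real N}|lborel.
        kH H (real n / real N) u - kH H ((real n - 1) / real N) u)"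

definition gn :: "real \<Rightarrow> real \<Rightarrow> nat \<Rightarrow> nat \<Rightarrow> real" where
  "gn H \<sigma> N n = \<sigma> * sqrt (real N) *
     (LINT u:{(real n - 1) / real N .. real n / real N}|lborel. kH H (real n / real N) u)"

definition an :: "(real \<Rightarrow> real) \<Rightarrow> nat \<Rightarrow> nat \<Rightarrow> real" where
  "an a N n = a (real n / real N) / real N"

text \<open>Elements x of {-1,1}^(n-1) are lists of length n-1; x_i is xs ! (i-1).
  The root tau of the tree is the empty list.\<close>
definition Yn :: "real \<Rightarrow> real \<Rightarrow> nat \<Rightarrow> nat \<Rightarrow> real list \<Rightarrow> real" where
  "Yn H \<sigma> N n xs = (\<Sum>i=1..n-1. Jn H \<sigma> N n i * xs ! (i - 1))"

definition un :: "real \<Rightarrow> real \<Rightarrow> nat \<Rightarrow> nat \<Rightarrow> real list \<Rightarrow> real" where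
  "un H \<sigma> N n xs = Yn H \<sigma> N n xs + gn H \<sigma> N n"

definition dn :: "real \<Rightarrow> real \<Rightarrow> nat \<Rightarrow> nat \<Rightarrow> real list \<Rightarrow> real" where
  "dn H \<sigma> N n xs = Yn H \<sigma> N n xs - gn H \<sigma> N n"

definition An :: "real \<Rightarrow> real \<Rightarrow> (real \<Rightarrow> real) \<Rightarrow> nat \<Rightarrow> nat \<Rightarrow> real list set" where
  "An H \<sigma> a N n = {xs. length xs = n - 1 \<and> set xs \<subseteq> {-1, 1} \<and>
      (un H \<sigma> N n xs \<le> - an a N n \<or> dn H \<sigma> N n xs \<ge> - an a N n)}"

definition Aset :: "real \<Rightarrow> real \<Rightarrow> (real \<Rightarrow> real) \<Rightarrow> nat \<Rightarrow> real list set" where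
  "Aset H \<sigma> a N = (\<Union>n\<in>{1..N}. An H \<sigma> a N n)"

definition hpar :: "real \<Rightarrow> real" where
  "hpar H = H / 2 + 1/4"

definition rho :: "real \<Rightarrow> nat \<Rightarrow> real" where
  "rho h k = ((real k + 1) powr (2*h) + (real k - 1) powr (2*h) - 2 * real k powr (2*h)) / 2"

definition gH :: "real \<Rightarrow> real \<Rightarrow> real" where
  "gH H \<sigma> = \<sigma> * cH H / (H + 1/2)"

text \<open>Probability space of an i.i.d. sequence of symmetric signs (xi_k), k \<ge> 1
  (coordinate 0 is unused).\<close>
definition Rad :: "(nat \<Rightarrow> real) measure" where
  "Rad = PiM UNIV (\<lambda>_. measure_pmf (pmf_of_set {-1::real, 1}))"

definition YH :: "real \<Rightarrow> real \<Rightarrow> (nat \<Rightarrow> real) \<Rightarrow> real" where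
  "YH H \<sigma> \<xi> = 2 * gH H \<sigma> * (\<Sum>k. rho (hpar H) (Suc k) * \<xi> (Suc k))"

end

theory Submission
  imports Defs "HOL-Real_Asymp.Real_Asymp"
begin

text \<open>By self-similarity of the kernel, \<open>Jn\<close> is \<open>2 * gH * N powr (- H)\<close> times a weight that
  depends only on \<open>H\<close>, and \<open>gn\<close> is the diagonal value of \<open>Jn\<close>. The estimate
  \<open>u powr (H - 1/2) \<le> s powr (H - 1/2) + (u - s) powr (H - 1/2)\<close> inside the kernel shows that the
  weight at \<open>i = n - k\<close> exceeds \<open>rho k\<close> (for \<open>k = 0\<close>: \<open>1/2\<close>) by at most a constant times
  \<open>k powr (2H - 2) * i powr (1/2 - H)\<close>, whose sum of squares over \<open>i + k = n\<close> tends to \<open>0\<close>, while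
  the drift term is of order \<open>N powr (H - 1)\<close>. Read backwards, the signs thus form weighted
  Rademacher sums that converge in probability to \<open>YH / (2 * gH)\<close>, and a node lies in \<open>An\<close> when
  \<open>gn \<le> \<bar>Yn + an\<bar>\<close>.

  The series \<open>YH\<close> converges almost surely by Kolmogorov's maximal inequality. The invariance of its
  law under sign flips shows that it has no atoms, so that the events \<open>\<bar>YH\<bar> > gH\<close> and \<open>\<bar>YH\<bar> \<ge> gH\<close>
  are equally likely, and, as \<open>rho\<close> is not summable, that these have positive probability.

  For the whole tree, the generation \<open>n = N - j\<close> carries the proportion \<open>2 powr (- j - 1)\<close> of the
  nodes, so the claim follows from the densities along \<open>N = n + j\<close>, for each fixed \<open>j\<close>, by dominated
  convergence.\<close>

section \<open>Inequalities, sums and integrals of powers\<close>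

lemma powr_diff_le:
  fixes x y b :: real
  assumes "0 \<le> x" "x \<le> y" "b \<le> 1"
  shows "y powr b - x powr b \<le> (y - x) * y powr (b - 1)"
proof (cases "x = 0")
  case True
  then show ?thesis using assms by (cases "y = 0") (auto simp: powr_diff)
next
  case False
  then have "0 < x" "0 < y" using assms by auto
  then have "x * y powr (b - 1) \<le> x * x powr (b - 1)"
    using assms by (intro mult_left_mono powr_mono2') auto
  moreover have "x * x powr (b - 1) = x powr b" "y * y powr (b - 1) = y powr b"
    using \<open>0 < x\<close> \<open>0 < y\<close> by (simp_all add: powr_diff)
  ultimately show ?thesis by (simp add: algebra_simps)
qed

lemma powr_add_le:
  fixes x y b :: real
  assumes "0 \<le> x" "0 \<le> y" "0 < b" "b \<le> 1"
  shows "(x + y) powr b \<le> x powr b + y powr b"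
proof (cases "y = 0")
  case False
  have "(x + y) powr b - x powr b \<le> y * (x + y) powr (b - 1)"
    using powr_diff_le[of x "x + y" b] assms by simp
  also have "\<dots> \<le> y * y powr (b - 1)"
    using assms False by (intro mult_left_mono powr_mono2') auto
  also have "\<dots> = y powr b" using assms False by (simp add: powr_diff)
  finally show ?thesis by simp
qed (use assms in auto)

lemma powr_mult_le_add:
  fixes x y a b :: real
  assumes "0 < x" "0 < y" "0 \<le> a" "0 \<le> b"
  shows "x powr (- a) * y powr (- b) \<le> x powr (- (a + b)) + y powr (- (a + b))"
proof (cases "x \<le> y")
  case True
  then have "x powr (- a) * y powr (- b) \<le> x powr (- a) * x powr (- b)"
    using assms by (intro mult_left_mono powr_mono2') auto
  also have "\<dots> = x powr (- (a + b))" by (simp flip: powr_add)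
  finally show ?thesis by (simp add: add_increasing2)
next
  case False
  then have "x powr (- a) * y powr (- b) \<le> y powr (- a) * y powr (- b)"
    using assms by (intro mult_right_mono powr_mono2') auto
  also have "\<dots> = y powr (- (a + b))" by (simp flip: powr_add)
  finally show ?thesis by (simp add: add_increasing)
qed

lemma summable_Suc_powr:
  assumes "p < -1"
  shows "summable (\<lambda>k. real (Suc k) powr p)"
  using assms summable_real_powr_iff[of p] by (subst summable_Suc_iff[of "\<lambda>k. real k powr p"]) simp

lemma powr_convolution_summand_le:
  fixes p q d :: real
  assumes "0 \<le> d" "d \<le> p" "d \<le> q" "k < n"
  shows "real (Suc k) powr (- p) * real (n - k) powr (- q) \<le> real n powr (- d) *
    (real (Suc k) powr (- (p + q - 2*d)) + real (n - k) powr (- (p + q - 2*d)))"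
proof -
  obtain j where n: "n = Suc (k + j)" using \<open>k < n\<close> less_imp_Suc_add by blast
  have "real n \<le> real (Suc k) * real (n - k)"
    by (simp add: n algebra_simps)
  then have product: "(real (Suc k) * real (n - k)) powr (- d) \<le> real n powr (- d)"
    using assms by (intro powr_mono2') auto
  have "real (Suc k) powr (- p) * real (n - k) powr (- q)
      = (real (Suc k) * real (n - k)) powr (- d) *
        (real (Suc k) powr (- (p - d)) * real (n - k) powr (- (q - d)))"
    using powr_add[of "real (Suc k)" "- d" "- (p - d)"]
      powr_add[of "real (n - k)" "- d" "- (q - d)"]
    by (simp add: powr_mult)
  also have "\<dots> \<le> real n powr (- d) * (real (Suc k) powr (- ((p - d) + (q - d)))
      + real (n - k) powr (- ((p - d) + (q - d))))"
    using product powr_mult_le_add[of "real (Suc k)" "real (n - k)" "p - d" "q - d"] assms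
    by (intro mult_mono) auto
  also have "(p - d) + (q - d) = p + q - 2*d"
    by simp
  finally show ?thesis .
qed

lemma powr_convolution_tendsto_0:
  fixes p q :: real
  assumes "0 < p" "0 < q" "1 < p + q"
  shows "(\<lambda>n. \<Sum>k<n. real (Suc k) powr (- p) * real (n - k) powr (- q)) \<longlonglongrightarrow> 0"
proof (rule tendsto_sandwich[OF _ _ tendsto_const])
  define d where "d = min (min p q) ((p + q - 1) / 2) / 2"
  have d: "0 < d" "d < p" "d < q" "2 * d < p + q - 1"
    using assms by (auto simp: d_def min_def)
  define r where "r = p + q - 2*d"
  define Z where "Z = (\<Sum>k. real (Suc k) powr (- r))"
  show "(\<lambda>n. real n powr (- d) * (2 * Z)) \<longlonglongrightarrow> 0"
    using d by real_asymp
  have partial_sum_le: "(\<Sum>k<n. real (Suc k) powr (- r)) \<le> Z" for n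
    using summable_Suc_powr[of "- r"] d unfolding Z_def by (intro sum_le_suminf) (auto simp: r_def)
  have "(\<Sum>k<n. real (Suc k) powr (- p) * real (n - k) powr (- q)) \<le> real n powr (- d) * (2 * Z)"
    for n
  proof -
    have "(\<Sum>k<n. real (Suc k) powr (- p) * real (n - k) powr (- q))
        \<le> (\<Sum>k<n. real n powr (- d) * (real (Suc k) powr (- r) + real (n - k) powr (- r)))"
      using powr_convolution_summand_le[of d p q] d unfolding r_def by (intro sum_mono) simp
    also have "\<dots> = real n powr (- d) *
        ((\<Sum>k<n. real (Suc k) powr (- r)) + (\<Sum>k<n. real (n - k) powr (- r)))"
      by (simp add: sum.distrib flip: sum_distrib_left)
    also have "(\<Sum>k<n. real (n - k) powr (- r)) = (\<Sum>k<n. real (Suc k) powr (- r))"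
      using sum.nat_diff_reindex[of "\<lambda>k. real (Suc k) powr (- r)" n] by (simp add: Suc_diff_Suc)
    also have "(\<Sum>k<n. real (Suc k) powr (- r)) + (\<Sum>k<n. real (Suc k) powr (- r)) \<le> 2 * Z"
      using partial_sum_le[of n] by simp
    finally show ?thesis by (simp add: mult_left_mono)
  qed
  then show "\<forall>\<^sub>F n in sequentially. (\<Sum>k<n. real (Suc k) powr (- p) * real (n - k) powr (- q))
      \<le> real n powr (- d) * (2 * Z)"
    by simp
qed (auto intro!: always_eventually sum_nonneg)

lemma set_integral_FTC_nonneg:
  fixes F f :: "real \<Rightarrow> real"
  assumes "x \<le> y" "finite S" "continuous_on {x..y} F"
    and "\<And>s. s \<in> {x<..<y} - S \<Longrightarrow> (F has_real_derivative f s) (at s)"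
    and [measurable]: "f \<in> borel_measurable borel"
    and nonneg: "\<And>s. 0 \<le> f s"
  shows "set_integrable lborel {x..y} f" "(LINT s:{x..y}|lborel. f s) = F y - F x"
proof -
  have integral: "(f has_integral (F y - F x)) {x..y}"
    using assms by (intro fundamental_theorem_of_calculus_interior_strong[of S])
      (auto simp: has_real_derivative_iff_has_vector_derivative)
  have "(\<lambda>s. if s \<in> {x..y} then f s else 0) = (\<lambda>s. indicator {x..y} s *\<^sub>R f s)"
    by (auto simp: indicator_def)
  then have "((\<lambda>s. indicator {x..y} s *\<^sub>R f s) has_integral (F y - F x)) UNIV"
    using integral has_integral_restrict_UNIV[of "{x..y}" f] by simp
  then have "integral\<^sup>N lborel (\<lambda>s. ennreal (indicator {x..y} s *\<^sub>R f s)) = ennreal (F y - F x)"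
    by (intro nn_integral_has_integral_lborel) (auto simp: nonneg)
  moreover have "0 \<le> F y - F x"
    by (rule has_integral_nonneg[OF integral]) (auto simp: nonneg)
  ultimately show "set_integrable lborel {x..y} f" "(LINT s:{x..y}|lborel. f s) = F y - F x"
    unfolding set_integrable_def set_lebesgue_integral_def
    by (auto intro!: integrableI_nonneg simp: nonneg integral_eq_nn_integral)
qed

lemma set_integral_shifted_powr:
  fixes s x y b :: real
  assumes "s \<le> x" "x \<le> y" "0 < b"
  shows "set_integrable lborel {x..y} (\<lambda>v. (v - s) powr (b - 1))"
    and "(LINT v:{x..y}|lborel. (v - s) powr (b - 1)) = ((y - s) powr b - (x - s) powr b) / b"
proof -
  have "continuous_on {x..y} (\<lambda>v. (v - s) powr b / b)"
    using assms by (intro continuous_intros continuous_on_powr') auto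
  moreover have "((\<lambda>v. (v - s) powr b / b) has_real_derivative (v - s) powr (b - 1)) (at v)"
    if "v \<in> {x<..<y} - {}" for v
    using that assms by (auto intro!: derivative_eq_intros)
  ultimately show "set_integrable lborel {x..y} (\<lambda>v. (v - s) powr (b - 1))"
    and "(LINT v:{x..y}|lborel. (v - s) powr (b - 1)) = ((y - s) powr b - (x - s) powr b) / b"
    using set_integral_FTC_nonneg[OF \<open>x \<le> y\<close> finite.emptyI, of "\<lambda>v. (v - s) powr b / b"]
    by (simp_all add: diff_divide_distrib)
qed

lemma set_integral_truncated_powr:
  fixes t x y b :: real
  assumes "x \<le> y" "0 < b"
  shows "set_integrable lborel {x..y} (\<lambda>s. max 0 (t - s) powr b)"
    and "(LINT s:{x..y}|lborel. max 0 (t - s) powr b)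
      = (max 0 (t - x) powr (b + 1) - max 0 (t - y) powr (b + 1)) / (b + 1)"
proof -
  let ?F = "\<lambda>s. - (max 0 (t - s) powr (b + 1) / (b + 1))"
  have continuous: "continuous_on {x..y} ?F"
    using assms by (intro continuous_intros continuous_on_powr') auto
  have derivative: "(?F has_real_derivative max 0 (t - s) powr b) (at s)"
    if "s \<in> {x<..<y} - {t}" for s
  proof (cases "s < t")
    case True
    then have "((\<lambda>s. - ((t - s) powr (b + 1) / (b + 1))) has_real_derivative (t - s) powr b) (at s)"
      using assms by (auto intro!: derivative_eq_intros)
    then have "(?F has_real_derivative (t - s) powr b) (at s)"
      by (rule has_field_derivative_transform_within_open[of _ _ _ "{..<t}"]) (use True in auto)
    then show ?thesis using True by (simp add: max_absorb2)
  next
    case False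
    have "(?F has_real_derivative 0) (at s)"
      by (rule has_field_derivative_transform_within_open[OF DERIV_const, where S = "{t<..}"])
        (use False that in auto)
    then show ?thesis using False by (simp add: max_absorb1)
  qed
  note FTC = set_integral_FTC_nonneg[where S = "{t}", OF \<open>x \<le> y\<close> _ continuous derivative]
  show "set_integrable lborel {x..y} (\<lambda>s. max 0 (t - s) powr b)"
    and "(LINT s:{x..y}|lborel. max 0 (t - s) powr b)
      = (max 0 (t - x) powr (b + 1) - max 0 (t - y) powr (b + 1)) / (b + 1)"
    using FTC by (simp_all add: diff_divide_distrib)
qed

lemma set_integral_between:
  fixes F f G :: "real \<Rightarrow> real"
  assumes F: "set_integrable lborel A F" and G: "set_integrable lborel A G"
    and [measurable]: "f \<in> borel_measurable borel" "A \<in> sets borel"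
    and bounds: "AE s \<in> A in lborel. F s \<le> f s \<and> f s \<le> G s"
  shows "(LINT s:A|lborel. F s) \<le> (LINT s:A|lborel. f s)"
    and "(LINT s:A|lborel. f s) \<le> (LINT s:A|lborel. G s)"
proof -
  have lower: "AE s \<in> A in lborel. F s \<le> f s" and upper: "AE s \<in> A in lborel. f s \<le> G s"
    using bounds by auto
  have f: "set_integrable lborel A f"
  proof (rule set_integrable_bound)
    show "set_integrable lborel A (\<lambda>s. \<bar>F s\<bar> + \<bar>G s\<bar>)"
      using F G by (intro set_integral_add set_integrable_abs)
    show "set_borel_measurable lborel A f"
      unfolding set_borel_measurable_def by measurable
    show "AE s in lborel. s \<in> A \<longrightarrow> norm (f s) \<le> norm (\<bar>F s\<bar> + \<bar>G s\<bar>)"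
      using bounds by eventually_elim auto
  qed
  show "(LINT s:A|lborel. F s) \<le> (LINT s:A|lborel. f s)"
    using F f lower by (rule set_integral_mono_AE)
  show "(LINT s:A|lborel. f s) \<le> (LINT s:A|lborel. G s)"
    using f G upper by (rule set_integral_mono_AE)
qed

lemma set_integral_scale:
  fixes f :: "real \<Rightarrow> real"
  assumes "0 < c"
  shows "(LINT u:{c * x..c * y}|lborel. f u) = c * (LINT u:{x..y}|lborel. f (c * u))"
proof -
  have "indicator {c * x..c * y} (c * u) = (indicator {x..y} u :: real)" for u
    using assms by (simp add: indicator_def)
  then show ?thesis
    unfolding set_lebesgue_integral_def
    using lborel_integral_real_affine[of c "\<lambda>u. indicator {c * x..c * y} u *\<^sub>R f u" 0] assms by simp
qed

section \<open>The Volterra kernel\<close>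

lemma cH_pos:
  assumes "1/2 < H" "H < 1"
  shows "0 < cH H"
  unfolding cH_def using assms by (auto intro!: divide_pos_pos mult_pos_pos Gamma_real_pos)

lemma gH_pos:
  assumes "1/2 < H" "H < 1" "0 < \<sigma>"
  shows "0 < gH H \<sigma>"
  unfolding gH_def using assms cH_pos by (auto intro!: divide_pos_pos mult_pos_pos)

lemma kH_eq_0:
  assumes "t \<le> s"
  shows "kH H t s = 0"
proof -
  have integrand: "indicat_real {s..t} u *\<^sub>R (u powr (H - 1/2) * (u - s) powr (H - 3/2)) = 0" for u
    using assms by (auto simp: indicator_def)
  show ?thesis
    unfolding kH_def set_lebesgue_integral_def integrand by simp
qed

lemma kH_scale:
  assumes "0 < c"
  shows "kH H (c * t) (c * s) = c powr (H - 1/2) * kH H t s"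
proof -
  let ?I = "LINT u:{s..t}|lborel. u powr (H - 1/2) * (u - s) powr (H - 3/2)"
  have "(c * u) powr (H - 1/2) * (c * u - c * s) powr (H - 3/2)
      = c powr (H - 1/2) * c powr (H - 3/2) * (u powr (H - 1/2) * (u - s) powr (H - 3/2))" for u
    by (simp add: powr_mult flip: right_diff_distrib)
  then have "kH H (c * t) (c * s)
      = CH H * (c * s) powr (1/2 - H) * (c * (c powr (H - 1/2) * c powr (H - 3/2) * ?I))"
    by (simp add: kH_def set_integral_scale[OF assms])
  also have "\<dots> = c powr (1/2 - H) * (c powr 1 * (c powr (H - 1/2) * c powr (H - 3/2))) * kH H t s"
    using assms by (simp add: kH_def powr_mult mult_ac)
  also have "c powr (1/2 - H) * (c powr 1 * (c powr (H - 1/2) * c powr (H - 3/2)))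
      = c powr (H - 1/2)"
    unfolding powr_add[symmetric] by simp
  finally show ?thesis .
qed

lemma borel_measurable_kH [measurable]: "kH H t \<in> borel_measurable borel"
proof -
  have integrand: "indicator {s..t} u *\<^sub>R (u powr (H - 1/2) * (u - s) powr (H - 3/2))
      = (if s \<le> u \<and> u \<le> t then u powr (H - 1/2) * (u - s) powr (H - 3/2) else 0)" for s u
    by (auto simp: indicator_def)
  have [measurable]: "(\<lambda>s. LINT u|lborel.
      (if s \<le> u \<and> u \<le> t then u powr (H - 1/2) * (u - s) powr (H - 3/2) else 0))
      \<in> borel_measurable borel"
    by (rule lborel.borel_measurable_lebesgue_integral) measurable
  show ?thesis
    unfolding kH_def[abs_def] set_lebesgue_integral_def integrand by measurable
qed

lemma set_integrable_kernel:
  fixes s t b :: real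
  assumes "0 \<le> s" "s \<le> t" "0 < b"
  shows "set_integrable lborel {s..t} (\<lambda>u. u powr b * (u - s) powr (b - 1))"
proof (rule set_integrable_bound)
  show "set_integrable lborel {s..t} (\<lambda>u. t powr b * (u - s) powr (b - 1))"
    using assms by (intro set_integrable_mult_right set_integral_shifted_powr) auto
  show "set_borel_measurable lborel {s..t} (\<lambda>u. u powr b * (u - s) powr (b - 1))"
    unfolding set_borel_measurable_def by measurable
  show "AE u in lborel. u \<in> {s..t} \<longrightarrow>
      norm (u powr b * (u - s) powr (b - 1)) \<le> norm (t powr b * (u - s) powr (b - 1))"
    using assms by (auto intro!: AE_I2 mult_right_mono powr_mono2 simp: abs_mult)
qed

text \<open>The lower bound comes from \<open>s \<le> u\<close>, the upper bound from
  \<open>u powr b \<le> s powr b + (u - s) powr b\<close>.\<close>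

lemma set_integral_kernel_bounds:
  fixes s x y b :: real
  assumes "0 \<le> s" "s \<le> x" "x \<le> y" "0 < b" "b \<le> 1"
  shows "s powr b * (((y - s) powr b - (x - s) powr b) / b)
      \<le> (LINT u:{x..y}|lborel. u powr b * (u - s) powr (b - 1))"
    and "(LINT u:{x..y}|lborel. u powr b * (u - s) powr (b - 1))
      \<le> s powr b * (((y - s) powr b - (x - s) powr b) / b)
        + ((y - s) powr (2*b) - (x - s) powr (2*b)) / (2*b)"
proof -
  let ?f = "\<lambda>u. u powr b * (u - s) powr (b - 1)"
  let ?F = "\<lambda>u. s powr b * (u - s) powr (b - 1)"
  let ?G = "\<lambda>u. s powr b * (u - s) powr (b - 1) + (u - s) powr (2*b - 1)"
  have "0 < 2*b" using assms by simp
  note linear = set_integral_shifted_powr[OF assms(2-4)]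
    and quadratic = set_integral_shifted_powr[OF assms(2,3) \<open>0 < 2*b\<close>]
  have F: "set_integrable lborel {x..y} ?F"
    by (intro set_integrable_mult_right linear)
  have G: "set_integrable lborel {x..y} ?G"
    by (intro set_integral_add(1) F quadratic)
  have "?F u \<le> ?f u \<and> ?f u \<le> ?G u" if "u \<in> {x..y}" for u
  proof
    show "?F u \<le> ?f u"
      using that assms by (intro mult_right_mono powr_mono2) auto
    have "?f u \<le> (s powr b + (u - s) powr b) * (u - s) powr (b - 1)"
      using powr_add_le[of s "u - s" b] that assms by (intro mult_right_mono) auto
    also have "\<dots> = ?G u"
      by (simp add: distrib_right flip: powr_add)
    finally show "?f u \<le> ?G u" .
  qed
  then have "AE u \<in> {x..y} in lborel. ?F u \<le> ?f u \<and> ?f u \<le> ?G u" by simp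
  note between = set_integral_between[OF F G _ _ this]
  show "s powr b * (((y - s) powr b - (x - s) powr b) / b) \<le> (LINT u:{x..y}|lborel. ?f u)"
    using between(1) by (simp add: linear)
  show "(LINT u:{x..y}|lborel. ?f u) \<le> s powr b * (((y - s) powr b - (x - s) powr b) / b)
      + ((y - s) powr (2*b) - (x - s) powr (2*b)) / (2*b)"
    using between(2) by (simp add: set_integral_add(2)[OF F quadratic(1)] linear quadratic(2))
qed

lemma kH_diff:
  assumes "1/2 < H" "0 \<le> s" "s \<le> x" "x \<le> y"
  shows "kH H y s - kH H x s
    = CH H * s powr (1/2 - H) * (LINT u:{x..y}|lborel. u powr (H - 1/2) * (u - s) powr (H - 3/2))"
proof -
  let ?f = "\<lambda>u. u powr (H - 1/2) * (u - s) powr (H - 3/2)"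
  have integrable: "set_integrable lborel {s..y} ?f"
    using set_integrable_kernel[of s y "H - 1/2"] assms by simp
  have henstock: "(LINT u:{v..w}|lborel. ?f u) = integral {v..w} ?f" if "s \<le> v" "w \<le> y" for v w
    using that
    by (intro set_borel_integral_eq_integral(2) set_integrable_subset[OF integrable]) auto
  have "integral {s..x} ?f + integral {x..y} ?f = integral {s..y} ?f"
    using assms set_borel_integral_eq_integral(1)[OF integrable]
    by (intro Henstock_Kurzweil_Integration.integral_combine) auto
  then have "(LINT u:{x..y}|lborel. ?f u)
      = (LINT u:{s..y}|lborel. ?f u) - (LINT u:{s..x}|lborel. ?f u)"
    using henstock[of x y] henstock[of s y] henstock[of s x] assms by linarith
  then show ?thesis
    unfolding kH_def by (simp only: right_diff_distrib)
qed

lemma kH_diff_bounds: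
  assumes H: "1/2 < H" "H < 1" and s: "0 < s" "s \<le> x" "x \<le> y"
  shows "cH H * ((y - s) powr (H - 1/2) - (x - s) powr (H - 1/2)) \<le> kH H y s - kH H x s"
    and "kH H y s - kH H x s \<le> cH H * ((y - s) powr (H - 1/2) - (x - s) powr (H - 1/2))
      + cH H / 2 * s powr (1/2 - H) * ((y - s) powr (2*H - 1) - (x - s) powr (2*H - 1))"
proof -
  define b where "b = H - 1/2"
  have b: "0 < b" "b \<le> 1" "H = b + 1/2" using H by (auto simp: b_def)
  let ?I = "LINT u:{x..y}|lborel. u powr b * (u - s) powr (b - 1)"
  define scale where "scale = cH H * b * s powr (-b)"
  have "0 \<le> scale" using cH_pos[OF H] b by (simp add: scale_def)
  have "s powr (-b) * s powr b = 1" using s by (simp flip: powr_add)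
  then have scale: "scale * (s powr b * (z / b)) = cH H * z"
    "scale * (z / (2*b)) = cH H / 2 * s powr (-b) * z" for z
    using b by (simp_all add: scale_def)
  have diff: "kH H y s - kH H x s = scale * ?I"
    using kH_diff[OF H(1) _ s(2,3)] s(1) by (simp add: scale_def CH_def b(3))
  note bounds = set_integral_kernel_bounds[OF less_imp_le[OF s(1)] s(2,3) b(1,2),
      THEN mult_left_mono, OF \<open>0 \<le> scale\<close>, folded diff]
  show "cH H * ((y - s) powr (H - 1/2) - (x - s) powr (H - 1/2)) \<le> kH H y s - kH H x s"
    using bounds(1) unfolding scale by (simp add: b(3))
  show "kH H y s - kH H x s \<le> cH H * ((y - s) powr (H - 1/2) - (x - s) powr (H - 1/2))
      + cH H / 2 * s powr (1/2 - H) * ((y - s) powr (2*H - 1) - (x - s) powr (2*H - 1))"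
    using bounds(2) unfolding distrib_left scale by (simp add: b(3))
qed

section \<open>Correlations and increment weights\<close>

lemma rho_bounds:
  assumes h: "1/2 < h" "h \<le> 1" and k: "1 \<le> k"
  shows "0 < rho h k" "rho h k \<le> h * real k powr (2*h - 2)"
proof -
  define p where "p = 2*h"
  have p: "1 < p" "p \<le> 2" "h = p / 2" using h by (auto simp: p_def)
  let ?increment = "\<lambda>x::real. (x + 1) powr p - x powr p"
  have derivative:
    "(?increment has_real_derivative p * ((z + 1) powr (p - 1) - z powr (p - 1))) (at z)"
    if "0 < z" for z
    using that by (auto intro!: derivative_eq_intros simp: algebra_simps)
  obtain z where z: "real k - 1 < z" "z < real k"
    and "?increment (real k) - ?increment (real k - 1)
      = p * ((z + 1) powr (p - 1) - z powr (p - 1))"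
  proof (rule mvt)
    show "continuous_on {real k - 1..real k} ?increment"
      using k p by (intro continuous_intros continuous_on_powr') auto
    show "(?increment has_derivative (*) (p * ((z + 1) powr (p - 1) - z powr (p - 1)))) (at z)"
      if "real k - 1 < z" "z < real k" for z
      using derivative that k by (simp add: has_field_derivative_def)
  qed simp_all
  then have rho: "rho h k = p / 2 * ((z + 1) powr (p - 1) - z powr (p - 1))"
    by (simp add: rho_def p(3))
  have "0 < z" using z k by simp
  then have "z powr (p - 1) < (z + 1) powr (p - 1)"
    using p by (intro powr_less_mono2) auto
  then show "0 < rho h k" unfolding rho using p by simp
  have "(z + 1) powr (p - 1) - z powr (p - 1) \<le> ((z + 1) - z) * (z + 1) powr (p - 1 - 1)"
    using \<open>0 < z\<close> p by (intro powr_diff_le) auto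
  also have "\<dots> \<le> real k powr (p - 2)"
    using \<open>0 < z\<close> z p k by (auto intro: powr_mono2')
  finally have "rho h k \<le> p / 2 * real k powr (p - 2)"
    unfolding rho using p by (intro mult_left_mono) auto
  then show "rho h k \<le> h * real k powr (2*h - 2)"
    by (simp add: p_def)
qed

lemma sum_rho: "(\<Sum>k<n. rho h (Suc k)) = ((real n + 1) powr (2*h) - real n powr (2*h) - 1) / 2"
  by (induction n) (auto simp: rho_def add_ac diff_divide_distrib add_divide_distrib)

lemma sum_rho_at_top:
  assumes "1/2 < h"
  shows "filterlim (\<lambda>n. \<Sum>k<n. rho h (Suc k)) at_top sequentially"
  unfolding sum_rho using assms by real_asymp

definition limit_weight :: "real \<Rightarrow> nat \<Rightarrow> real" where
  "limit_weight H k = (if k = 0 then 1/2 else rho (hpar H) k)"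

definition kernel_increment :: "real \<Rightarrow> nat \<Rightarrow> real \<Rightarrow> real" where
  "kernel_increment H n s = kH H (real n) s - kH H (real n - 1) s"

definition power_increment :: "real \<Rightarrow> nat \<Rightarrow> real \<Rightarrow> real" where
  "power_increment H n s =
    max 0 (real n - s) powr (H - 1/2) - max 0 (real n - 1 - s) powr (H - 1/2)"

definition weight :: "real \<Rightarrow> nat \<Rightarrow> nat \<Rightarrow> real" where
  "weight H n i =
    (H + 1/2) / (2 * cH H) * (LINT s:{real i - 1..real i}|lborel. kernel_increment H n s)"

lemma Jn_eq_weight:
  assumes H: "1/2 < H" "H < 1" and "0 < N"
  shows "Jn H \<sigma> N n i = 2 * gH H \<sigma> * real N powr (- H) * weight H n i"
proof -
  define c where "c = 1 / real N"
  have "0 < c" using \<open>0 < N\<close> by (simp add: c_def)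
  let ?I = "LINT s:{real i - 1..real i}|lborel. kernel_increment H n s"
  have "Jn H \<sigma> N n i = \<sigma> * sqrt (real N) * (LINT u:{c * (real i - 1)..c * real i}|lborel.
      kH H (c * real n) u - kH H (c * (real n - 1)) u)"
    by (simp add: Jn_def c_def)
  also have "\<dots> = \<sigma> * (sqrt (real N) * c * c powr (H - 1/2)) * ?I"
    by (simp add: set_integral_scale[OF \<open>0 < c\<close>] kH_scale[OF \<open>0 < c\<close>] kernel_increment_def
        flip: right_diff_distrib)
  also have "sqrt (real N) * c * c powr (H - 1/2)
      = real N powr (1/2) * real N powr (- 1) * real N powr (1/2 - H)"
    using \<open>0 < N\<close> by (simp add: c_def powr_half_sqrt powr_divide powr_minus_divide powr_diff)
  also have "\<dots> = real N powr (- H)"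
    unfolding powr_add[symmetric] by simp
  also have "\<sigma> * real N powr (- H) * ?I = 2 * gH H \<sigma> * real N powr (- H) * weight H n i"
    using H cH_pos[OF H] by (simp add: gH_def weight_def)
  finally show ?thesis .
qed

lemma gn_eq_Jn:
  assumes "1 \<le> n" "0 < N"
  shows "gn H \<sigma> N n = Jn H \<sigma> N n n"
proof -
  have "kH H ((real n - 1) / real N) u = 0" if "u \<in> {(real n - 1) / real N..real n / real N}" for u
    using that by (intro kH_eq_0) simp
  then have "(LINT u:{(real n - 1) / real N..real n / real N}|lborel. kH H (real n / real N) u)
      = (LINT u:{(real n - 1) / real N..real n / real N}|lborel.
          kH H (real n / real N) u - kH H ((real n - 1) / real N) u)"
    by (intro set_lebesgue_integral_cong) simp_all
  then show ?thesis
    by (simp add: gn_def Jn_def)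
qed

lemma kernel_increment_bounds:
  assumes H: "1/2 < H" "H < 1" and i: "1 \<le> i" "i \<le> n" and s: "0 < s" "s \<in> {real i - 1..real i}"
  shows "cH H * power_increment H n s \<le> kernel_increment H n s"
    and "kernel_increment H n s \<le> cH H * power_increment H n s
      + cH H / 2 * max 1 (real (n - i)) powr (2*H - 2) * s powr (1/2 - H)"
proof -
  define x where "x = max s (real n - 1)"
  have x: "s \<le> x" "x \<le> real n" "max 0 (real n - 1 - s) = x - s" "max 0 (real n - s) = real n - s"
    using i s by (auto simp: x_def max_def)
  have "kH H (real n - 1) s = kH H x s"
    by (cases "s \<le> real n - 1") (simp_all add: x_def max_def kH_eq_0)
  then have increments: "kernel_increment H n s = kH H (real n) s - kH H x s"
    "power_increment H n s = (real n - s) powr (H - 1/2) - (x - s) powr (H - 1/2)"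
    by (simp_all only: kernel_increment_def power_increment_def x(3,4))
  note bounds = kH_diff_bounds[OF H s(1) x(1,2)]
  show "cH H * power_increment H n s \<le> kernel_increment H n s"
    unfolding increments by (rule bounds)
  have "(real n - s) powr (2*H - 1) - (x - s) powr (2*H - 1) \<le> max 1 (real (n - i)) powr (2*H - 2)"
  proof (cases "i < n")
    case True
    then have "x = real n - 1" using s by (simp add: x_def)
    then have "(real n - s) powr (2*H - 1) - (x - s) powr (2*H - 1) \<le> (real n - s) powr (2*H - 2)"
      using powr_diff_le[of "x - s" "real n - s" "2*H - 1"] x H by simp
    also have "\<dots> \<le> max 1 (real (n - i)) powr (2*H - 2)"
      using True s i H by (intro powr_mono2') auto
    finally show ?thesis .
  next
    case False
    then have "(real n - s) powr (2*H - 1) \<le> 1"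
      using i s H by (intro powr_le1) auto
    moreover have "x = s" using False i s by (simp add: x_def)
    ultimately show ?thesis using False by simp
  qed
  then have "cH H / 2 * s powr (1/2 - H) * ((real n - s) powr (2*H - 1) - (x - s) powr (2*H - 1))
      \<le> cH H / 2 * max 1 (real (n - i)) powr (2*H - 2) * s powr (1/2 - H)"
    using cH_pos[OF H] by (simp add: mult_left_mono mult_ac)
  then show "kernel_increment H n s \<le> cH H * power_increment H n s
      + cH H / 2 * max 1 (real (n - i)) powr (2*H - 2) * s powr (1/2 - H)"
    using bounds(2) unfolding increments by linarith
qed

lemma set_integral_singular_powr:
  fixes b :: real
  assumes "0 \<le> b" "b < 1" "1 \<le> i"
  shows "set_integrable lborel {real i - 1..real i} (\<lambda>s. s powr (- b))"
    and "(LINT s:{real i - 1..real i}|lborel. s powr (- b)) \<le> real i powr (- b) / (1 - b)"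
proof -
  note integral = set_integral_shifted_powr[of 0 "real i - 1" "real i" "1 - b"]
  show "set_integrable lborel {real i - 1..real i} (\<lambda>s. s powr (- b))"
    using integral(1) assms by simp
  have "real i powr (1 - b) - (real i - 1) powr (1 - b) \<le> real i powr (- b)"
    using powr_diff_le[of "real i - 1" "real i" "1 - b"] assms by simp
  then show "(LINT s:{real i - 1..real i}|lborel. s powr (- b)) \<le> real i powr (- b) / (1 - b)"
    using integral(2) assms by (simp add: divide_right_mono)
qed

text \<open>The value arises as a second difference of truncated powers. Truncation matters on the diagonal
  only, where the difference is \<open>1\<close>; off the diagonal it is \<open>2 * rho\<close>.\<close>

lemma set_integral_power_increment:
  assumes "1/2 < H" "i \<le> n"
  shows "set_integrable lborel {real i - 1..real i} (power_increment H n)"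
    and "(LINT s:{real i - 1..real i}|lborel. power_increment H n s)
      = 2 / (H + 1/2) * limit_weight H (n - i)"
proof -
  let ?T = "\<lambda>x::real. max 0 x powr (H + 1/2)"
  have truncated: "set_integrable lborel {real i - 1..real i} (\<lambda>s. max 0 (t - s) powr (H - 1/2))"
    "(LINT s:{real i - 1..real i}|lborel. max 0 (t - s) powr (H - 1/2))
      = (?T (t - real i + 1) - ?T (t - real i)) / (H + 1/2)" for t
    using set_integral_truncated_powr[of "real i - 1" "real i" "H - 1/2" t] assms
    by (simp_all add: algebra_simps)
  note difference = set_integral_diff[OF truncated(1) truncated(1), of "real n" "real n - 1"]
  show "set_integrable lborel {real i - 1..real i} (power_increment H n)"
    unfolding power_increment_def[abs_def] by (rule difference(1))
  have "(LINT s:{real i - 1..real i}|lborel. power_increment H n s)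
    = (?T (real n - real i + 1) - ?T (real n - real i)) / (H + 1/2)
      - (?T (real n - real i) - ?T (real n - real i - 1)) / (H + 1/2)"
    unfolding power_increment_def difference(2) truncated(2) by (simp add: algebra_simps)
  also have "\<dots> = (?T (real n - real i + 1) + ?T (real n - real i - 1) - 2 * ?T (real n - real i))
      / (H + 1/2)"
    by (simp add: diff_divide_distrib add_divide_distrib)
  also have "?T (real n - real i + 1) + ?T (real n - real i - 1) - 2 * ?T (real n - real i)
      = 2 * limit_weight H (n - i)"
    using assms by (auto simp: limit_weight_def rho_def hpar_def of_nat_diff)
  finally show "(LINT s:{real i - 1..real i}|lborel. power_increment H n s)
      = 2 / (H + 1/2) * limit_weight H (n - i)"
    by simp
qed

lemma set_integral_kernel_increment_bounds:
  assumes H: "1/2 < H" "H < 1" and i: "1 \<le> i" "i \<le> n"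
  defines "main \<equiv> 2 * cH H / (H + 1/2) * limit_weight H (n - i)"
  shows "main \<le> (LINT s:{real i - 1..real i}|lborel. kernel_increment H n s)"
    and "(LINT s:{real i - 1..real i}|lborel. kernel_increment H n s)
      \<le> main + cH H / 2 * max 1 (real (n - i)) powr (2*H - 2) * (real i powr (1/2 - H) / (3/2 - H))"
proof -
  let ?cell = "{real i - 1..real i}"
  define C where "C = cH H / 2 * max 1 (real (n - i)) powr (2*H - 2)"
  have "0 \<le> C" using cH_pos[OF H] by (simp add: C_def)
  note singular = set_integral_singular_powr[of "H - 1/2" i]
  have integrable: "set_integrable lborel ?cell (\<lambda>s. cH H * power_increment H n s)"
    "set_integrable lborel ?cell (\<lambda>s. C * s powr (1/2 - H))"
    using singular(1) set_integral_power_increment(1) H i by simp_all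
  have main: "(LINT s:?cell|lborel. cH H * power_increment H n s) = main"
    by (simp add: set_integral_power_increment(2)[OF H(1) i(2)] main_def)
  have [measurable]: "kernel_increment H n \<in> borel_measurable borel"
    unfolding kernel_increment_def[abs_def] by measurable
  have "AE s \<in> ?cell in lborel. cH H * power_increment H n s \<le> kernel_increment H n s \<and>
      kernel_increment H n s \<le> cH H * power_increment H n s + C * s powr (1/2 - H)"
    using AE_lborel_singleton[of "0::real"]
  proof eventually_elim
    case (elim s)
    have "0 < s" if "s \<in> ?cell" using that elim i by simp
    then show ?case
      unfolding C_def using kernel_increment_bounds[OF H i] by blast
  qed
  note bounds = set_integral_between[OF integrable(1) set_integral_add(1)[OF integrable] _ _ this]
  show "main \<le> (LINT s:?cell|lborel. kernel_increment H n s)"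
    using bounds(1) unfolding main by simp
  have "(LINT s:?cell|lborel. kernel_increment H n s)
      \<le> main + C * (LINT s:?cell|lborel. s powr (1/2 - H))"
    using bounds(2) unfolding set_integral_add(2)[OF integrable] main by simp
  also have "\<dots> \<le> main + C * (real i powr (1/2 - H) / (3/2 - H))"
    using singular(2) H i \<open>0 \<le> C\<close> by (intro add_left_mono mult_left_mono) simp_all
  finally show "(LINT s:?cell|lborel. kernel_increment H n s)
      \<le> main + cH H / 2 * max 1 (real (n - i)) powr (2*H - 2) * (real i powr (1/2 - H) / (3/2 - H))"
    unfolding C_def .
qed

lemma weight_bounds:
  assumes H: "1/2 < H" "H < 1" and i: "1 \<le> i" "i \<le> n"
  shows "limit_weight H (n - i) \<le> weight H n i"
    and "weight H n i \<le> limit_weight H (n - i) + (2*H + 1) / (4 * (3 - 2*H)) *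
      (max 1 (real (n - i)) powr (2*H - 2) * real i powr (1/2 - H))"
proof -
  let ?scale = "(H + 1/2) / (2 * cH H)"
  have "0 < cH H" by (rule cH_pos[OF H])
  then have "0 \<le> ?scale" and scale: "?scale * (2 * cH H / (H + 1/2) * z) = z" for z
    using H by auto
  note bounds = set_integral_kernel_increment_bounds[OF H i, THEN mult_left_mono, OF \<open>0 \<le> ?scale\<close>]
  show "limit_weight H (n - i) \<le> weight H n i"
    using bounds(1) unfolding weight_def scale .
  have "weight H n i \<le> limit_weight H (n - i) + ?scale *
      (cH H / 2 * max 1 (real (n - i)) powr (2*H - 2) * (real i powr (1/2 - H) / (3/2 - H)))"
    using bounds(2) unfolding weight_def distrib_left scale .
  also have "?scale *
        (cH H / 2 * max 1 (real (n - i)) powr (2*H - 2) * (real i powr (1/2 - H) / (3/2 - H)))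
      = (2*H + 1) / (4 * (3 - 2*H)) * (max 1 (real (n - i)) powr (2*H - 2) * real i powr (1/2 - H))"
    using \<open>0 < cH H\<close> H by (simp add: divide_simps)
  finally show "weight H n i \<le> limit_weight H (n - i) + (2*H + 1) / (4 * (3 - 2*H)) *
      (max 1 (real (n - i)) powr (2*H - 2) * real i powr (1/2 - H))" .
qed

lemma infinite_range_pos_tendsto_0:
  fixes c :: "nat \<Rightarrow> real"
  assumes "\<And>k. 0 < c k" "c \<longlonglongrightarrow> 0"
  shows "infinite (range c)"
proof
  assume "finite (range c)"
  then have "Min (range c) \<in> range c" by (rule Min_in) simp
  then have "0 < Min (range c)" using assms(1) by auto
  then have "\<forall>\<^sub>F k in sequentially. c k < Min (range c)"
    by (rule order_tendstoD(2)[OF assms(2)])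
  then obtain k where "c k < Min (range c)"
    by (auto simp: eventually_sequentially)
  moreover have "Min (range c) \<le> c k"
    using \<open>finite (range c)\<close> by simp
  ultimately show False by simp
qed

context
  fixes H :: real
  assumes H: "1/2 < H" "H < 1"
begin

lemma limit_weight_Suc_bounds:
  shows "0 < limit_weight H (Suc k)"
    and "limit_weight H (Suc k) \<le> hpar H * real (Suc k) powr (H - 3/2)"
proof -
  have "1/2 < hpar H" "hpar H \<le> 1" "2 * hpar H - 2 = H - 3/2"
    using H by (auto simp: hpar_def)
  then show "0 < limit_weight H (Suc k)"
    and "limit_weight H (Suc k) \<le> hpar H * real (Suc k) powr (H - 3/2)"
    using rho_bounds[of "hpar H" "Suc k"] by (simp_all add: limit_weight_def)
qed

lemma summable_limit_weight_square: "summable (\<lambda>k. (limit_weight H (Suc k))\<^sup>2)"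
proof (rule summable_comparison_test')
  show "summable (\<lambda>k. (hpar H)\<^sup>2 * real (Suc k) powr (2*H - 3))"
    using H by (intro summable_mult summable_Suc_powr) auto
  fix k :: nat
  have "(limit_weight H (Suc k))\<^sup>2 \<le> (hpar H * real (Suc k) powr (H - 3/2))\<^sup>2"
    using limit_weight_Suc_bounds[of k] by (intro power_mono) auto
  then show "norm ((limit_weight H (Suc k))\<^sup>2) \<le> (hpar H)\<^sup>2 * real (Suc k) powr (2*H - 3)"
    by (simp add: power_mult_distrib powr_power algebra_simps)
qed

lemma infinite_range_limit_weight: "infinite (range (\<lambda>k. \<bar>limit_weight H (Suc k)\<bar>))"
proof (rule infinite_range_pos_tendsto_0)
  show "0 < \<bar>limit_weight H (Suc k)\<bar>" for k
    using limit_weight_Suc_bounds(1)[of k] by simp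
  have "(\<lambda>k. limit_weight H (Suc k)) \<longlonglongrightarrow> 0"
  proof (rule tendsto_sandwich[OF _ _ tendsto_const])
    show "(\<lambda>k. hpar H * real (Suc k) powr (H - 3/2)) \<longlonglongrightarrow> 0"
      using H by real_asymp
  qed (use limit_weight_Suc_bounds in \<open>auto intro!: always_eventually less_imp_le\<close>)
  then show "(\<lambda>k. \<bar>limit_weight H (Suc k)\<bar>) \<longlonglongrightarrow> 0"
    by (rule tendsto_rabs_zero)
qed

lemma sum_limit_weight_exceeds: "\<exists>n. t < (\<Sum>k<n. limit_weight H (Suc k))"
proof -
  have "filterlim (\<lambda>n. \<Sum>k<n. limit_weight H (Suc k)) at_top sequentially"
    using sum_rho_at_top[of "hpar H"] H by (simp add: limit_weight_def hpar_def)
  then show ?thesis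
    by (auto simp: filterlim_at_top_dense eventually_sequentially)
qed

lemma weight_row_tendsto:
  "(\<lambda>n. \<Sum>k<n. (weight H (Suc n) (n - k) - limit_weight H (Suc k))\<^sup>2) \<longlonglongrightarrow> 0"
proof (rule tendsto_sandwich[OF _ _ tendsto_const])
  define K where "K = (2*H + 1) / (4 * (3 - 2*H))"
  let ?convolution = "\<lambda>n. \<Sum>k<n. real (Suc k) powr (- (4 - 4*H)) * real (n - k) powr (- (2*H - 1))"
  show "(\<lambda>n. K\<^sup>2 * ?convolution n) \<longlonglongrightarrow> 0"
    using H by (intro tendsto_mult_right_zero powr_convolution_tendsto_0) auto
  have "(weight H (Suc n) (n - k) - limit_weight H (Suc k))\<^sup>2
      \<le> K\<^sup>2 * (real (Suc k) powr (- (4 - 4*H)) * real (n - k) powr (- (2*H - 1)))" if "k < n" for n k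
  proof -
    have range: "1 \<le> n - k" "n - k \<le> Suc n" and diff: "Suc n - (n - k) = Suc k"
      using that by auto
    have max: "max 1 (real (Suc k)) = real (Suc k)" by simp
    have "0 \<le> weight H (Suc n) (n - k) - limit_weight H (Suc k)"
      "weight H (Suc n) (n - k) - limit_weight H (Suc k)
        \<le> K * (real (Suc k) powr (2*H - 2) * real (n - k) powr (1/2 - H))"
      using weight_bounds[OF H range] unfolding diff max K_def by linarith+
    then have "(weight H (Suc n) (n - k) - limit_weight H (Suc k))\<^sup>2
        \<le> (K * (real (Suc k) powr (2*H - 2) * real (n - k) powr (1/2 - H)))\<^sup>2"
      by (intro power_mono)
    also have "\<dots> = K\<^sup>2 * (real (Suc k) powr (- (4 - 4*H)) * real (n - k) powr (- (2*H - 1)))"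
    proof -
      have "(real (Suc k) powr (2*H - 2))\<^sup>2 = real (Suc k) powr (- (4 - 4*H))"
        "(real (n - k) powr (1/2 - H))\<^sup>2 = real (n - k) powr (- (2*H - 1))"
        by (simp_all add: power2_eq_square flip: powr_add)
      then show ?thesis by (simp only: power_mult_distrib)
    qed
    finally show ?thesis .
  qed
  then show "\<forall>\<^sub>F n in sequentially.
      (\<Sum>k<n. (weight H (Suc n) (n - k) - limit_weight H (Suc k))\<^sup>2) \<le> K\<^sup>2 * ?convolution n"
    by (auto simp: sum_distrib_left intro!: always_eventually sum_mono)
qed (auto intro!: always_eventually sum_nonneg)

lemma weight_diagonal_tendsto: "(\<lambda>n. weight H (Suc n) (Suc n)) \<longlonglongrightarrow> 1/2"
proof (rule tendsto_sandwich[OF _ _ tendsto_const])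
  define K where "K = (2*H + 1) / (4 * (3 - 2*H))"
  show "\<forall>\<^sub>F n in sequentially. 1/2 \<le> weight H (Suc n) (Suc n)"
    using weight_bounds(1)[OF H, of "Suc n" "Suc n" for n] by (simp add: limit_weight_def)
  show "\<forall>\<^sub>F n in sequentially. weight H (Suc n) (Suc n) \<le> 1/2 + K * real (Suc n) powr (1/2 - H)"
    using weight_bounds(2)[OF H, of "Suc n" "Suc n" for n] by (simp add: limit_weight_def K_def)
  show "(\<lambda>n. 1/2 + K * real (Suc n) powr (1/2 - H)) \<longlonglongrightarrow> 1/2"
    using H by real_asymp
qed

end

section \<open>Convergence in probability\<close>

context prob_space
begin

definition tendsto_in_prob ::
    "('i \<Rightarrow> 'a \<Rightarrow> 'b::real_normed_vector) \<Rightarrow> ('a \<Rightarrow> 'b) \<Rightarrow> 'i filter \<Rightarrow> bool" where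
  "tendsto_in_prob X Y F \<longleftrightarrow>
    (\<forall>e>0. ((\<lambda>i. prob {\<omega>\<in>space M. e \<le> norm (X i \<omega> - Y \<omega>)}) \<longlongrightarrow> 0) F)"

lemma tendsto_in_prob_const:
  assumes "(x \<longlongrightarrow> y) F"
  shows "tendsto_in_prob (\<lambda>i _. x i) (\<lambda>_. y) F"
  unfolding tendsto_in_prob_def
proof (intro allI impI tendsto_eventually)
  fix e :: real assume "0 < e"
  then have "\<forall>\<^sub>F i in F. norm (x i - y) < e"
    using assms by (simp add: tendsto_iff dist_norm)
  then show "\<forall>\<^sub>F i in F. prob {\<omega>\<in>space M. e \<le> norm (x i - y)} = 0"
    by eventually_elim (simp add: not_le)
qed

lemma tendsto_in_prob_AE:
  fixes X :: "nat \<Rightarrow> 'a \<Rightarrow> 'b::{second_countable_topology, real_normed_vector}"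
  assumes [measurable]: "\<And>n. random_variable borel (X n)" "random_variable borel Y"
    and lim: "AE \<omega> in M. (\<lambda>n. X n \<omega>) \<longlonglongrightarrow> Y \<omega>"
  shows "tendsto_in_prob X Y sequentially"
  unfolding tendsto_in_prob_def
proof (intro allI impI)
  fix e :: real assume "0 < e"
  define far where "far n = {\<omega>\<in>space M. e \<le> norm (X n \<omega> - Y \<omega>)}" for n
  have [measurable]: "far n \<in> events" for n
    unfolding far_def by measurable
  have "(\<lambda>n. expectation (indicat_real (far n))) \<longlonglongrightarrow> expectation (\<lambda>_. 0)"
  proof (rule integral_dominated_convergence[where w = "\<lambda>_. 1"])
    show "AE \<omega> in M. (\<lambda>n. indicat_real (far n) \<omega>) \<longlonglongrightarrow> 0"
      using lim
    proof eventually_elim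
      case (elim \<omega>)
      then have "\<forall>\<^sub>F n in sequentially. norm (X n \<omega> - Y \<omega>) < e"
        using \<open>0 < e\<close> by (simp add: tendsto_iff dist_norm)
      then show ?case
        by (intro tendsto_eventually, eventually_elim) (simp add: far_def)
    qed
  qed (auto simp: indicator_def)
  then show "(\<lambda>n. prob {\<omega>\<in>space M. e \<le> norm (X n \<omega> - Y \<omega>)}) \<longlonglongrightarrow> 0"
    by (simp add: far_def)
qed

lemma tendsto_in_prob_add:
  fixes X X' :: "'i \<Rightarrow> 'a \<Rightarrow> 'b::{second_countable_topology, real_normed_vector}"
  assumes [measurable]: "\<And>i. random_variable borel (X i)" "random_variable borel Y"
      "\<And>i. random_variable borel (X' i)" "random_variable borel Y'"
    and "tendsto_in_prob X Y F" "tendsto_in_prob X' Y' F"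
  shows "tendsto_in_prob (\<lambda>i \<omega>. X i \<omega> + X' i \<omega>) (\<lambda>\<omega>. Y \<omega> + Y' \<omega>) F"
  unfolding tendsto_in_prob_def
proof (intro allI impI, rule tendsto_sandwich[OF _ _ tendsto_const])
  fix e :: real assume "0 < e"
  define far where "far i = {\<omega>\<in>space M. e/2 \<le> norm (X i \<omega> - Y \<omega>)}" for i
  define far' where "far' i = {\<omega>\<in>space M. e/2 \<le> norm (X' i \<omega> - Y' \<omega>)}" for i
  have [measurable]: "far i \<in> events" "far' i \<in> events" for i
    unfolding far_def far'_def by measurable
  have "((\<lambda>i. prob (far i)) \<longlongrightarrow> 0) F" "((\<lambda>i. prob (far' i)) \<longlongrightarrow> 0) F"
    using assms(5,6) half_gt_zero[OF \<open>0 < e\<close>]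
    unfolding tendsto_in_prob_def far_def far'_def by blast+
  from tendsto_add[OF this] show "((\<lambda>i. prob (far i) + prob (far' i)) \<longlongrightarrow> 0) F"
    by simp
  have "prob {\<omega>\<in>space M. e \<le> norm (X i \<omega> + X' i \<omega> - (Y \<omega> + Y' \<omega>))} \<le> prob (far i) + prob (far' i)"
    for i
  proof -
    have "e/2 \<le> norm (X i \<omega> - Y \<omega>) \<or> e/2 \<le> norm (X' i \<omega> - Y' \<omega>)"
      if "e \<le> norm (X i \<omega> + X' i \<omega> - (Y \<omega> + Y' \<omega>))" for \<omega>
      using that norm_diff_triangle_ineq[of "X i \<omega>" "X' i \<omega>" "Y \<omega>" "Y' \<omega>"] by linarith
    then have "{\<omega>\<in>space M. e \<le> norm (X i \<omega> + X' i \<omega> - (Y \<omega> + Y' \<omega>))} \<subseteq> far i \<union> far' i"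
      unfolding far_def far'_def by blast
    then have "prob {\<omega>\<in>space M. e \<le> norm (X i \<omega> + X' i \<omega> - (Y \<omega> + Y' \<omega>))} \<le> prob (far i \<union> far' i)"
      by (rule finite_measure_mono) measurable
    also have "\<dots> \<le> prob (far i) + prob (far' i)"
      by (rule measure_Un_le) measurable
    finally show ?thesis .
  qed
  then show "\<forall>\<^sub>F i in F. prob {\<omega>\<in>space M. e \<le> norm (X i \<omega> + X' i \<omega> - (Y \<omega> + Y' \<omega>))}
      \<le> prob (far i) + prob (far' i)"
    by simp
qed simp

lemma tendsto_in_prob_norm:
  fixes X :: "'i \<Rightarrow> 'a \<Rightarrow> 'b::{second_countable_topology, real_normed_vector}"
  assumes [measurable]: "\<And>i. random_variable borel (X i)" "random_variable borel Y"
    and "tendsto_in_prob X Y F"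
  shows "tendsto_in_prob (\<lambda>i \<omega>. norm (X i \<omega>)) (\<lambda>\<omega>. norm (Y \<omega>)) F"
  unfolding tendsto_in_prob_def
proof (intro allI impI, rule tendsto_sandwich[OF _ _ tendsto_const])
  fix e :: real assume "0 < e"
  then show "((\<lambda>i. prob {\<omega>\<in>space M. e \<le> norm (X i \<omega> - Y \<omega>)}) \<longlongrightarrow> 0) F"
    using assms(3) by (simp add: tendsto_in_prob_def)
  have "prob {\<omega>\<in>space M. e \<le> norm (norm (X i \<omega>) - norm (Y \<omega>))}
      \<le> prob {\<omega>\<in>space M. e \<le> norm (X i \<omega> - Y \<omega>)}" for i
    by (rule finite_measure_mono) (auto intro: order_trans[OF _ norm_triangle_ineq3])
  then show "\<forall>\<^sub>F i in F. prob {\<omega>\<in>space M. e \<le> norm (norm (X i \<omega>) - norm (Y \<omega>))}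
      \<le> prob {\<omega>\<in>space M. e \<le> norm (X i \<omega> - Y \<omega>)}"
    by simp
qed simp

lemma abs_prob_diff_le:
  assumes "A \<in> events" "B \<in> events" "C \<in> events" "A \<subseteq> B \<union> C" "B \<subseteq> A \<union> C"
  shows "\<bar>prob A - prob B\<bar> \<le> prob C"
proof -
  have "prob A \<le> prob (B \<union> C)" "prob B \<le> prob (A \<union> C)"
    using assms by (auto intro!: finite_measure_mono)
  moreover have "prob (B \<union> C) \<le> prob B + prob C" "prob (A \<union> C) \<le> prob A + prob C"
    using assms by (auto intro!: measure_Un_le)
  ultimately show ?thesis by linarith
qed

lemma prob_abs_le_arbitrarily_small:
  fixes Z :: "'a \<Rightarrow> real"
  assumes [measurable]: "random_variable borel Z"
    and "prob {\<omega>\<in>space M. Z \<omega> = 0} = 0" "0 < r"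
  obtains d where "0 < d" "prob {\<omega>\<in>space M. \<bar>Z \<omega>\<bar> \<le> d} < r"
proof -
  define near where "near j = {\<omega>\<in>space M. \<bar>Z \<omega>\<bar> \<le> inverse (real (Suc j))}" for j
  have "(\<lambda>j. prob (near j)) \<longlonglongrightarrow> prob (\<Inter>j. near j)"
  proof (rule finite_Lim_measure_decseq)
    have "near j \<in> events" for j
      unfolding near_def by measurable
    then show "range near \<subseteq> events" by blast
    have "inverse (real (Suc (Suc j))) \<le> inverse (real (Suc j))" for j
      by (intro le_imp_inverse_le) auto
    then show "decseq near"
      unfolding near_def by (intro decseq_SucI) (blast intro: order_trans)
  qed
  also have "(\<Inter>j. near j) = {\<omega>\<in>space M. Z \<omega> = 0}"
  proof (intro equalityI subsetI)
    fix \<omega> assume near: "\<omega> \<in> (\<Inter>j. near j)"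
    have "Z \<omega> = 0"
    proof (rule ccontr)
      assume "Z \<omega> \<noteq> 0"
      then obtain j where "inverse (real (Suc j)) < \<bar>Z \<omega>\<bar>"
        using reals_Archimedean[of "\<bar>Z \<omega>\<bar>"] by auto
      moreover have "\<omega> \<in> near j" using near by blast
      ultimately show False by (simp add: near_def)
    qed
    then show "\<omega> \<in> {\<omega>\<in>space M. Z \<omega> = 0}" using near by (auto simp: near_def)
  qed (auto simp: near_def)
  finally have "(\<lambda>j. prob (near j)) \<longlonglongrightarrow> 0"
    using assms(2) by simp
  then obtain j where "prob (near j) < r"
    using order_tendstoD(2)[of _ 0 sequentially r] \<open>0 < r\<close> eventually_happens by force
  then show ?thesis
    by (intro that[of "inverse (real (Suc j))"]) (simp_all add: near_def)
qed

lemma prob_nonneg_tendsto: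
  fixes Z :: "'i \<Rightarrow> 'a \<Rightarrow> real"
  assumes [measurable]: "\<And>i. random_variable borel (Z i)" "random_variable borel Z'"
    and lim: "tendsto_in_prob Z Z' F" and no_atom: "prob {\<omega>\<in>space M. Z' \<omega> = 0} = 0"
  shows "((\<lambda>i. prob {\<omega>\<in>space M. 0 \<le> Z i \<omega>}) \<longlongrightarrow> prob {\<omega>\<in>space M. 0 < Z' \<omega>}) F"
proof (rule tendstoI)
  fix r :: real assume "0 < r"
  then obtain d where d: "0 < d" "prob {\<omega>\<in>space M. \<bar>Z' \<omega>\<bar> \<le> d} < r / 2"
    using prob_abs_le_arbitrarily_small[OF _ no_atom, of "r / 2"] by auto
  let ?near = "{\<omega>\<in>space M. \<bar>Z' \<omega>\<bar> \<le> d}" and ?far = "\<lambda>i. {\<omega>\<in>space M. d \<le> norm (Z i \<omega> - Z' \<omega>)}"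
  have "\<forall>\<^sub>F i in F. prob (?far i) < r / 2"
    using lim d(1) \<open>0 < r\<close> unfolding tendsto_in_prob_def by (intro order_tendstoD(2)[of _ 0]) auto
  then show "\<forall>\<^sub>F i in F. dist (prob {\<omega>\<in>space M. 0 \<le> Z i \<omega>}) (prob {\<omega>\<in>space M. 0 < Z' \<omega>}) < r"
  proof eventually_elim
    case (elim i)
    have "\<bar>prob {\<omega>\<in>space M. 0 \<le> Z i \<omega>} - prob {\<omega>\<in>space M. 0 < Z' \<omega>}\<bar> \<le> prob (?near \<union> ?far i)"
      by (rule abs_prob_diff_le) auto
    also have "\<dots> \<le> prob ?near + prob (?far i)"
      by (rule measure_Un_le) measurable
    finally show ?case
      using d(2) elim by (simp add: dist_real_def)
  qed
qed

end

section \<open>Series of independent centred random variables\<close>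

text \<open>Freezing the partial sums once they reach \<open>e\<close> turns the event that some partial sum up to time
  \<open>n\<close> reaches \<open>e\<close> into an event at time \<open>n\<close> alone, to which Markov's inequality applies.\<close>

primrec stopped_sum :: "real \<Rightarrow> (nat \<Rightarrow> real) \<Rightarrow> nat \<Rightarrow> real" where
  "stopped_sum e x 0 = 0"
| "stopped_sum e x (Suc n) =
    (if e \<le> \<bar>stopped_sum e x n\<bar> then stopped_sum e x n else stopped_sum e x n + x n)"

lemma stopped_sum_cong: "(\<And>k. k < n \<Longrightarrow> x k = y k) \<Longrightarrow> stopped_sum e x n = stopped_sum e y n"
  by (induction n) auto

lemma measurable_stopped_sum:
  assumes "\<And>k. k < n \<Longrightarrow> (\<lambda>\<omega>. X \<omega> k) \<in> borel_measurable M"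
  shows "(\<lambda>\<omega>. stopped_sum e (X \<omega>) n) \<in> borel_measurable M"
  using assms by (induction n) auto

lemma stopped_sum_reaches:
  assumes "0 < e" "m \<le> n" "e \<le> \<bar>\<Sum>k<m. x k\<bar>"
  shows "e \<le> \<bar>stopped_sum e x n\<bar>"
proof -
  have "e \<le> \<bar>stopped_sum e x n\<bar> \<or>
      (stopped_sum e x n = (\<Sum>k<n. x k) \<and> (\<forall>m\<le>n. \<bar>\<Sum>k<m. x k\<bar> < e))"
    using \<open>0 < e\<close> by (induction n) (auto simp: le_Suc_eq)
  then show ?thesis using assms by force
qed

locale indep_centered_sequence = prob_space +
  fixes X :: "nat \<Rightarrow> 'a \<Rightarrow> real"
  assumes indep: "indep_vars (\<lambda>_. borel) X UNIV"
    and square_integrable: "\<And>k. integrable M (\<lambda>\<omega>. (X k \<omega>)\<^sup>2)"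
    and expectation_eq_0: "\<And>k. expectation (X k) = 0"
begin

lemma random_variable [measurable]: "random_variable borel (X k)"
  using indep by (simp add: indep_vars_def)

lemma integrable: "integrable M (X k)"
  by (rule square_integrable_imp_integrable[OF random_variable square_integrable])

lemma indep_centered_sequence_scale: "indep_centered_sequence M (\<lambda>k \<omega>. c k * X k \<omega>)"
proof unfold_locales
  show "indep_vars (\<lambda>_. borel) (\<lambda>k \<omega>. c k * X k \<omega>) UNIV"
    by (rule indep_vars_compose2[OF indep]) simp
  show "integrable M (\<lambda>\<omega>. (c k * X k \<omega>)\<^sup>2)" for k
    using square_integrable by (simp add: power_mult_distrib)
  show "expectation (\<lambda>\<omega>. c k * X k \<omega>) = 0" for k
    by (simp add: expectation_eq_0)
qed

lemma indep_var_past: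
  assumes "f \<in> borel_measurable (Pi\<^sub>M {..<n} (\<lambda>_. borel))"
  shows "indep_var borel (\<lambda>\<omega>. f (\<lambda>k\<in>{..<n}. X k \<omega>)) borel (X n)"
proof -
  have "indep_var (Pi\<^sub>M {..<n} (\<lambda>_. borel)) (\<lambda>\<omega>. \<lambda>k\<in>{..<n}. X k \<omega>)
      (Pi\<^sub>M {n} (\<lambda>_. borel)) (\<lambda>\<omega>. \<lambda>k\<in>{n}. X k \<omega>)"
    by (rule indep_var_restrict[OF indep]) auto
  then have "indep_var borel (f \<circ> (\<lambda>\<omega>. \<lambda>k\<in>{..<n}. X k \<omega>)) borel ((\<lambda>x. x n) \<circ> (\<lambda>\<omega>. \<lambda>k\<in>{n}. X k \<omega>))"
    using assms by (rule indep_var_compose) simp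
  then show ?thesis by (simp add: comp_def)
qed

abbreviation stopped :: "real \<Rightarrow> nat \<Rightarrow> 'a \<Rightarrow> real" where
  "stopped e n \<omega> \<equiv> stopped_sum e (\<lambda>k. X k \<omega>) n"

lemma random_variable_stopped [measurable]: "random_variable borel (stopped e n)"
  by (rule measurable_stopped_sum) simp

lemma stopped_orthogonal:
  fixes e :: real and n :: nat
  defines "running \<equiv> \<lambda>\<omega>. if e \<le> \<bar>stopped e n \<omega>\<bar> then 0 else stopped e n \<omega>"
  shows "integrable M (\<lambda>\<omega>. running \<omega> * X n \<omega>)" "expectation (\<lambda>\<omega>. running \<omega> * X n \<omega>) = 0"
proof -
  define f where "f x = (if e \<le> \<bar>stopped_sum e x n\<bar> then 0 else stopped_sum e x n)" for x
  have [measurable]: "(\<lambda>x. stopped_sum e x n) \<in> borel_measurable (Pi\<^sub>M {..<n} (\<lambda>_. borel))"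
    by (rule measurable_stopped_sum) simp
  have "f \<in> borel_measurable (Pi\<^sub>M {..<n} (\<lambda>_. borel))"
    unfolding f_def by measurable
  then have "indep_var borel (\<lambda>\<omega>. f (\<lambda>k\<in>{..<n}. X k \<omega>)) borel (X n)"
    by (rule indep_var_past)
  moreover have "stopped_sum e (\<lambda>k\<in>{..<n}. X k \<omega>) n = stopped e n \<omega>" for \<omega>
    by (rule stopped_sum_cong) simp
  ultimately have indep_running: "indep_var borel running borel (X n)"
    by (simp add: f_def running_def cong: if_cong)
  have "integrable M running"
  proof (rule integrable_const_bound)
    show "AE \<omega> in M. norm (running \<omega>) \<le> \<bar>e\<bar>" by (simp add: running_def)
  qed (simp add: running_def)
  then show "integrable M (\<lambda>\<omega>. running \<omega> * X n \<omega>)" "expectation (\<lambda>\<omega>. running \<omega> * X n \<omega>) = 0"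
    using indep_var_integrable[OF indep_running _ integrable]
      indep_var_lebesgue_integral[OF indep_running _ integrable]
    by (simp_all add: expectation_eq_0)
qed

lemma expectation_stopped_square:
  shows "integrable M (\<lambda>\<omega>. (stopped e n \<omega>)\<^sup>2)"
    and "expectation (\<lambda>\<omega>. (stopped e n \<omega>)\<^sup>2) \<le> (\<Sum>k<n. expectation (\<lambda>\<omega>. (X k \<omega>)\<^sup>2))"
proof (induction n)
  case (Suc n)
  let ?running = "\<lambda>\<omega>. if e \<le> \<bar>stopped e n \<omega>\<bar> then 0 else stopped e n \<omega>"
  define bound where "bound \<omega> = (stopped e n \<omega>)\<^sup>2 + 2 * (?running \<omega> * X n \<omega>) + (X n \<omega>)\<^sup>2" for \<omega>
  have square_le: "(stopped e (Suc n) \<omega>)\<^sup>2 \<le> bound \<omega>" for \<omega>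
    by (simp add: bound_def power2_sum)
  have "integrable M bound"
    unfolding bound_def using Suc(1) stopped_orthogonal(1)[of e n] square_integrable
    by (intro Bochner_Integration.integrable_add integrable_mult_right)
  have "AE \<omega> in M. norm ((stopped e (Suc n) \<omega>)\<^sup>2) \<le> norm (bound \<omega>)"
    unfolding real_norm_def abs_power2 by (intro AE_I2 order_trans[OF square_le abs_ge_self])
  then show integrable_Suc: "integrable M (\<lambda>\<omega>. (stopped e (Suc n) \<omega>)\<^sup>2)"
    by (rule Bochner_Integration.integrable_bound[OF \<open>integrable M bound\<close>, rotated]) measurable
  have "expectation (\<lambda>\<omega>. (stopped e (Suc n) \<omega>)\<^sup>2) \<le> expectation bound"
    using integrable_Suc \<open>integrable M bound\<close> square_le by (rule integral_mono)
  also have "\<dots> = expectation (\<lambda>\<omega>. (stopped e n \<omega>)\<^sup>2) + expectation (\<lambda>\<omega>. (X n \<omega>)\<^sup>2)"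
    unfolding bound_def using Suc(1) stopped_orthogonal[of e n] square_integrable by simp
  finally show "expectation (\<lambda>\<omega>. (stopped e (Suc n) \<omega>)\<^sup>2) \<le> (\<Sum>k<Suc n. expectation (\<lambda>\<omega>. (X k \<omega>)\<^sup>2))"
    using Suc(2) by simp
qed simp_all

theorem Kolmogorov_maximal_inequality:
  assumes "0 < e"
  shows "prob {\<omega>\<in>space M. \<exists>m\<le>n. e \<le> \<bar>\<Sum>k<m. X k \<omega>\<bar>} \<le> (\<Sum>k<n. expectation (\<lambda>\<omega>. (X k \<omega>)\<^sup>2)) / e\<^sup>2"
proof -
  have "prob {\<omega>\<in>space M. \<exists>m\<le>n. e \<le> \<bar>\<Sum>k<m. X k \<omega>\<bar>} \<le> prob {\<omega>\<in>space M. e\<^sup>2 \<le> (stopped e n \<omega>)\<^sup>2}"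
  proof (rule finite_measure_mono)
    show "{\<omega>\<in>space M. \<exists>m\<le>n. e \<le> \<bar>\<Sum>k<m. X k \<omega>\<bar>} \<subseteq> {\<omega>\<in>space M. e\<^sup>2 \<le> (stopped e n \<omega>)\<^sup>2}"
      using stopped_sum_reaches[OF assms] assms by (fastforce simp: abs_le_square_iff[symmetric])
  qed measurable
  also have "\<dots> \<le> expectation (\<lambda>\<omega>. (stopped e n \<omega>)\<^sup>2) / e\<^sup>2"
    using assms
    by (intro integral_Markov_inequality_measure[of _ _ "{}"] expectation_stopped_square) auto
  also have "\<dots> \<le> (\<Sum>k<n. expectation (\<lambda>\<omega>. (X k \<omega>)\<^sup>2)) / e\<^sup>2"
    by (intro divide_right_mono expectation_stopped_square) simp
  finally show ?thesis .
qed

lemma maximal_inequality_suminf: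
  assumes "0 < e" "summable (\<lambda>k. expectation (\<lambda>\<omega>. (X k \<omega>)\<^sup>2))"
  shows "prob {\<omega>\<in>space M. \<exists>m. e \<le> \<bar>\<Sum>k<m. X k \<omega>\<bar>} \<le> (\<Sum>k. expectation (\<lambda>\<omega>. (X k \<omega>)\<^sup>2)) / e\<^sup>2"
proof -
  define exceeds where "exceeds n = {\<omega>\<in>space M. \<exists>m\<le>n. e \<le> \<bar>\<Sum>k<m. X k \<omega>\<bar>}" for n
  have "exceeds n \<in> events" for n
    unfolding exceeds_def by measurable
  then have "(\<lambda>n. prob (exceeds n)) \<longlonglongrightarrow> prob (\<Union>n. exceeds n)"
    by (intro finite_Lim_measure_incseq) (auto simp: exceeds_def incseq_def intro: order_trans)
  moreover have "prob (exceeds n) \<le> (\<Sum>k. expectation (\<lambda>\<omega>. (X k \<omega>)\<^sup>2)) / e\<^sup>2" for n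
  proof -
    have "prob (exceeds n) \<le> (\<Sum>k<n. expectation (\<lambda>\<omega>. (X k \<omega>)\<^sup>2)) / e\<^sup>2"
      unfolding exceeds_def by (rule Kolmogorov_maximal_inequality[OF \<open>0 < e\<close>])
    also have "\<dots> \<le> (\<Sum>k. expectation (\<lambda>\<omega>. (X k \<omega>)\<^sup>2)) / e\<^sup>2"
      using assms by (intro divide_right_mono sum_le_suminf) auto
    finally show ?thesis .
  qed
  ultimately have "prob (\<Union>n. exceeds n) \<le> (\<Sum>k. expectation (\<lambda>\<omega>. (X k \<omega>)\<^sup>2)) / e\<^sup>2"
    by (intro LIMSEQ_le_const2) auto
  moreover have "(\<Union>n. exceeds n) = {\<omega>\<in>space M. \<exists>m. e \<le> \<bar>\<Sum>k<m. X k \<omega>\<bar>}"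
    by (auto simp: exceeds_def)
  ultimately show ?thesis by simp
qed

lemma prob_tail_le:
  assumes "0 < e" and summable: "summable (\<lambda>k. expectation (\<lambda>\<omega>. (X k \<omega>)\<^sup>2))"
  shows "prob {\<omega>\<in>space M. \<exists>n\<ge>m. e \<le> \<bar>(\<Sum>k<n. X k \<omega>) - (\<Sum>k<m. X k \<omega>)\<bar>}
    \<le> (\<Sum>k. expectation (\<lambda>\<omega>. (X (k + m) \<omega>)\<^sup>2)) / e\<^sup>2"
proof -
  define tail where "tail k \<omega> = of_bool (m \<le> k) * X k \<omega>" for k \<omega>
  interpret tail: indep_centered_sequence M tail
    unfolding tail_def by (rule indep_centered_sequence_scale)
  have tail_sum: "(\<Sum>k<n. tail k \<omega>) = (\<Sum>k<n. X k \<omega>) - (\<Sum>k<m. X k \<omega>)" if "m \<le> n" for n \<omega>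
    using that by (induction n rule: dec_induct) (auto simp: tail_def)
  have expectation_tail:
    "expectation (\<lambda>\<omega>. (tail k \<omega>)\<^sup>2) = (if m \<le> k then expectation (\<lambda>\<omega>. (X k \<omega>)\<^sup>2) else 0)" for k
    by (simp add: tail_def)
  have summable_tail: "summable (\<lambda>k. expectation (\<lambda>\<omega>. (tail k \<omega>)\<^sup>2))"
    using summable by (rule summable_comparison_test') (simp add: expectation_tail)
  have "prob {\<omega>\<in>space M. \<exists>n\<ge>m. e \<le> \<bar>(\<Sum>k<n. X k \<omega>) - (\<Sum>k<m. X k \<omega>)\<bar>}
      \<le> prob {\<omega>\<in>space M. \<exists>n. e \<le> \<bar>\<Sum>k<n. tail k \<omega>\<bar>}"
    by (rule finite_measure_mono) (auto simp flip: tail_sum)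
  also have "\<dots> \<le> (\<Sum>k. expectation (\<lambda>\<omega>. (tail k \<omega>)\<^sup>2)) / e\<^sup>2"
    by (rule tail.maximal_inequality_suminf[OF \<open>0 < e\<close> summable_tail])
  also have "(\<Sum>k. expectation (\<lambda>\<omega>. (tail k \<omega>)\<^sup>2)) = (\<Sum>k. expectation (\<lambda>\<omega>. (X (k + m) \<omega>)\<^sup>2))"
    using suminf_split_initial_segment[OF summable_tail, of m] by (simp add: expectation_tail)
  finally show ?thesis .
qed

lemma AE_eventually_partial_sums_close:
  assumes "0 < e" and summable: "summable (\<lambda>k. expectation (\<lambda>\<omega>. (X k \<omega>)\<^sup>2))"
  shows "AE \<omega> in M. \<exists>m. \<forall>n\<ge>m. \<bar>(\<Sum>k<n. X k \<omega>) - (\<Sum>k<m. X k \<omega>)\<bar> < e"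
proof -
  define oscillates where
    "oscillates m = {\<omega>\<in>space M. \<exists>n\<ge>m. e \<le> \<bar>(\<Sum>k<n. X k \<omega>) - (\<Sum>k<m. X k \<omega>)\<bar>}" for m
  have [measurable]: "oscillates m \<in> events" for m
    unfolding oscillates_def by measurable
  have "prob (\<Inter>m. oscillates m) \<le> (\<Sum>k. expectation (\<lambda>\<omega>. (X (k + m) \<omega>)\<^sup>2)) / e\<^sup>2" for m
  proof -
    have "prob (\<Inter>m. oscillates m) \<le> prob (oscillates m)"
      by (rule finite_measure_mono) auto
    also have "\<dots> \<le> (\<Sum>k. expectation (\<lambda>\<omega>. (X (k + m) \<omega>)\<^sup>2)) / e\<^sup>2"
      unfolding oscillates_def by (rule prob_tail_le[OF assms])
    finally show ?thesis .
  qed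
  moreover have "(\<lambda>m. (\<Sum>k. expectation (\<lambda>\<omega>. (X (k + m) \<omega>)\<^sup>2)) / e\<^sup>2) \<longlonglongrightarrow> 0"
    by (intro tendsto_divide_zero suminf_exist_split2[OF summable])
  ultimately have "prob (\<Inter>m. oscillates m) \<le> 0"
    by (intro LIMSEQ_le_const) auto
  then have "(\<Inter>m. oscillates m) \<in> null_sets M"
    by (simp add: null_sets_def emeasure_eq_measure measure_le_0_iff)
  then show ?thesis
    by (rule AE_I'[of "\<Inter>m. oscillates m"]) (auto simp: oscillates_def not_less)
qed

theorem AE_summable:
  assumes "summable (\<lambda>k. expectation (\<lambda>\<omega>. (X k \<omega>)\<^sup>2))"
  shows "AE \<omega> in M. summable (\<lambda>k. X k \<omega>)"
proof -
  have "AE \<omega> in M. \<forall>j. \<exists>m. \<forall>n\<ge>m. \<bar>(\<Sum>k<n. X k \<omega>) - (\<Sum>k<m. X k \<omega>)\<bar> < inverse (real (Suc j))"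
    unfolding AE_all_countable using AE_eventually_partial_sums_close[OF _ assms] by simp
  then show ?thesis
  proof eventually_elim
    case (elim \<omega>)
    have "Cauchy (\<lambda>n. \<Sum>k<n. X k \<omega>)"
      unfolding Cauchy_altdef2
    proof (intro allI impI)
      fix e :: real assume "0 < e"
      then obtain j where "inverse (real (Suc j)) < e" using reals_Archimedean by auto
      moreover obtain m where "\<forall>n\<ge>m. \<bar>(\<Sum>k<n. X k \<omega>) - (\<Sum>k<m. X k \<omega>)\<bar> < inverse (real (Suc j))"
        using elim by blast
      ultimately show "\<exists>m. \<forall>n\<ge>m. dist (\<Sum>k<n. X k \<omega>) (\<Sum>k<m. X k \<omega>) < e"
        by (intro exI[of _ m]) (force simp: dist_real_def)
    qed
    then show ?case
      by (simp add: summable_iff_convergent Cauchy_convergent_iff)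
  qed
qed

end

section \<open>Rademacher series\<close>

context product_prob_space
begin

lemma indep_vars_component: "P.indep_vars M (\<lambda>i \<omega>. \<omega> i) I"
proof (cases "I = {}")
  case False
  have "distr (Pi\<^sub>M I M) (Pi\<^sub>M I M) (\<lambda>\<omega>. \<lambda>i\<in>I. \<omega> i) = distr (Pi\<^sub>M I M) (Pi\<^sub>M I M) (\<lambda>\<omega>. \<omega>)"
    by (rule distr_cong) (auto simp: space_PiM PiE_restrict)
  also have "\<dots> = (\<Pi>\<^sub>M i\<in>I. distr (Pi\<^sub>M I M) (M i) (\<lambda>\<omega>. \<omega> i))"
    by (simp add: PiM_component cong: PiM_cong)
  finally show ?thesis
    using False by (subst P.indep_vars_iff_distr_eq_PiM') auto
next
  case True
  then show ?thesis
    unfolding P.indep_vars_def P.indep_sets_def by auto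
qed

lemma distr_PiM_componentwise:
  assumes f [measurable]: "\<And>i. i \<in> I \<Longrightarrow> f i \<in> M i \<rightarrow>\<^sub>M M i"
    and preserved: "\<And>i. i \<in> I \<Longrightarrow> distr (M i) (M i) (f i) = M i"
  shows "distr (Pi\<^sub>M I M) (Pi\<^sub>M I M) (\<lambda>\<omega>. \<lambda>i\<in>I. f i (\<omega> i)) = Pi\<^sub>M I M"
proof (cases "I = {}")
  case True
  then have "distr (Pi\<^sub>M I M) (Pi\<^sub>M I M) (\<lambda>\<omega>. \<lambda>i\<in>I. f i (\<omega> i)) = distr (Pi\<^sub>M I M) (Pi\<^sub>M I M) (\<lambda>\<omega>. \<omega>)"
    by (intro distr_cong) (auto simp: space_PiM)
  then show ?thesis by simp
next
  case False
  have "P.indep_vars M (\<lambda>i \<omega>. f i (\<omega> i)) I"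
    by (rule P.indep_vars_compose2[OF indep_vars_component f])
  then have "distr (Pi\<^sub>M I M) (Pi\<^sub>M I M) (\<lambda>\<omega>. \<lambda>i\<in>I. f i (\<omega> i))
      = (\<Pi>\<^sub>M i\<in>I. distr (Pi\<^sub>M I M) (M i) (\<lambda>\<omega>. f i (\<omega> i)))"
    using False by (subst (asm) P.indep_vars_iff_distr_eq_PiM') auto
  also have "\<dots> = Pi\<^sub>M I M"
  proof (rule PiM_cong[OF refl])
    fix i assume "i \<in> I"
    then have "distr (Pi\<^sub>M I M) (M i) (\<lambda>\<omega>. f i (\<omega> i))
        = distr (distr (Pi\<^sub>M I M) (M i) (\<lambda>\<omega>. \<omega> i)) (M i) (f i)"
      by (subst distr_distr) (auto simp: comp_def)
    then show "distr (Pi\<^sub>M I M) (M i) (\<lambda>\<omega>. f i (\<omega> i)) = M i"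
      using \<open>i \<in> I\<close> by (simp add: PiM_component preserved)
  qed
  finally show ?thesis .
qed

end

lemma measure_Collect_invariant:
  assumes [measurable]: "T \<in> M \<rightarrow>\<^sub>M M" "Measurable.pred M P" and "distr M M T = M"
  shows "measure M {\<omega>\<in>space M. P (T \<omega>)} = measure M {\<omega>\<in>space M. P \<omega>}"
proof -
  have "measure M {\<omega>\<in>space M. P \<omega>} = measure (distr M M T) {\<omega>\<in>space M. P \<omega>}"
    by (simp add: \<open>distr M M T = M\<close>)
  also have "\<dots> = measure M (T -` {\<omega>\<in>space M. P \<omega>} \<inter> space M)"
    by (rule measure_distr) measurable
  also have "T -` {\<omega>\<in>space M. P \<omega>} \<inter> space M = {\<omega>\<in>space M. P (T \<omega>)}"
    by (auto dest: measurable_space[OF assms(1)])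
  finally show ?thesis ..
qed

abbreviation sign_measure :: "real measure" where
  "sign_measure \<equiv> measure_pmf (pmf_of_set {-1, 1})"

interpretation Rad_product: product_prob_space "\<lambda>_::nat. sign_measure" UNIV
  by unfold_locales

interpretation Rad: prob_space Rad
  unfolding Rad_def by unfold_locales

lemma measurable_Rad_component_discrete [measurable]: "(\<lambda>\<xi>. \<xi> k) \<in> Rad \<rightarrow>\<^sub>M count_space UNIV"
proof -
  have "(\<lambda>\<xi>. \<xi> k) \<in> Rad \<rightarrow>\<^sub>M sign_measure"
    unfolding Rad_def by measurable
  then show ?thesis by simp
qed

lemma measurable_Rad_component [measurable]: "(\<lambda>\<xi>. \<xi> k) \<in> borel_measurable Rad"
  by (rule measurable_compose[OF measurable_Rad_component_discrete]) simp

lemma measurable_into_Rad: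
  assumes "\<And>k. (\<lambda>\<omega>. f \<omega> k) \<in> M \<rightarrow>\<^sub>M count_space UNIV"
  shows "f \<in> M \<rightarrow>\<^sub>M Rad"
  unfolding Rad_def by (rule measurable_PiM_single') (use assms in simp_all)

lemma distr_Rad_component: "distr Rad sign_measure (\<lambda>\<xi>. \<xi> k) = sign_measure"
  unfolding Rad_def by (rule Rad_product.PiM_component) simp

lemma AE_Rad_sign: "AE \<xi> in Rad. \<forall>k. \<xi> k \<in> {-1, 1}"
  unfolding AE_all_countable Rad_def
  by (intro allI Rad_product.AE_component) (auto simp: AE_measure_pmf_iff)

lemma Rad_cylinder:
  assumes "finite J" "\<And>k. k \<in> J \<Longrightarrow> x k \<in> {-1, 1}"
  shows "Rad.prob {\<xi>\<in>space Rad. \<forall>k\<in>J. \<xi> k = x k} = (1/2) ^ card J"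
proof -
  have "emeasure Rad {\<xi>\<in>space Rad. \<forall>k\<in>J. \<xi> k = x k} = (\<Prod>k\<in>J. emeasure sign_measure {x k})"
    using Rad_product.emeasure_PiM_Collect[of J "\<lambda>k. {x k}"] assms(1)
    unfolding Rad_def[symmetric] by simp
  also have "\<dots> = (\<Prod>k\<in>J. ennreal (1/2))"
    using assms by (intro prod.cong refl) (auto simp: emeasure_pmf_single)
  also have "\<dots> = ennreal (\<Prod>k\<in>J. 1/2)" by (rule prod_ennreal) simp
  finally show ?thesis by (simp add: measure_def)
qed

lemma Rad_prob_map_mem:
  assumes "distinct ks" and A: "A \<subseteq> {xs. set xs \<subseteq> {-1, 1} \<and> length xs = length ks}"
  shows "Rad.prob {\<xi>\<in>space Rad. map \<xi> ks \<in> A} = real (card A) / 2 ^ length ks"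
    and "{\<xi>\<in>space Rad. map \<xi> ks \<in> A} \<in> sets Rad"
proof -
  have "finite A"
    by (rule finite_subset[OF A finite_lists_length_eq]) simp
  define fibre where "fibre xs = {\<xi>\<in>space Rad. map \<xi> ks = xs}" for xs
  have fibre: "fibre xs \<in> sets Rad \<and> Rad.prob (fibre xs) = (1/2) ^ length ks" if "xs \<in> A" for xs
  proof -
    define x where "x k = the (map_of (zip ks xs) k)" for k
    have "length xs = length ks" "set xs \<subseteq> {-1, 1}" using A that by auto
    then have x: "map x ks = xs"
      using \<open>distinct ks\<close> by (intro nth_equalityI) (simp_all add: x_def map_of_zip_nth)
    then have "fibre xs = {\<xi>\<in>space Rad. \<forall>k\<in>set ks. \<xi> k = x k}"
      by (auto simp: fibre_def)
    moreover have "x k \<in> {-1, 1}" if "k \<in> set ks" for k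
      using that \<open>set xs \<subseteq> {-1, 1}\<close> x by (metis imageI list.set_map subsetD)
    ultimately show ?thesis
      using \<open>distinct ks\<close> by (simp add: Rad_cylinder distinct_card)
  qed
  have Union: "{\<xi>\<in>space Rad. map \<xi> ks \<in> A} = (\<Union>xs\<in>A. fibre xs)"
    by (auto simp: fibre_def)
  show "{\<xi>\<in>space Rad. map \<xi> ks \<in> A} \<in> sets Rad"
    unfolding Union using \<open>finite A\<close> fibre by blast
  have "Rad.prob (\<Union>xs\<in>A. fibre xs) = (\<Sum>xs\<in>A. Rad.prob (fibre xs))"
    using \<open>finite A\<close> fibre
    by (intro Rad.finite_measure_finite_Union) (auto simp: fibre_def disjoint_family_on_def)
  also have "\<dots> = real (card A) / 2 ^ length ks"
    using fibre by (simp add: power_one_over)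
  finally show "Rad.prob {\<xi>\<in>space Rad. map \<xi> ks \<in> A} = real (card A) / 2 ^ length ks"
    unfolding Union .
qed

definition flip :: "nat set \<Rightarrow> (nat \<Rightarrow> real) \<Rightarrow> nat \<Rightarrow> real" where
  "flip F \<xi> k = (if k \<in> F then - \<xi> k else \<xi> k)"

lemma distr_sign_measure_uminus: "distr sign_measure sign_measure uminus = sign_measure"
proof -
  have "distr sign_measure sign_measure uminus = measure_pmf (map_pmf uminus (pmf_of_set {-1, 1}))"
    unfolding map_pmf_rep_eq by (rule distr_cong) simp_all
  also have "map_pmf uminus (pmf_of_set {-1, 1 :: real}) = pmf_of_set (uminus ` {-1, 1})"
    by (rule map_pmf_of_set_inj) simp_all
  also have "uminus ` {-1, 1} = {-1, 1 :: real}" by auto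
  finally show ?thesis .
qed

lemma measurable_flip [measurable]: "flip F \<in> Rad \<rightarrow>\<^sub>M Rad"
proof (rule measurable_into_Rad)
  show "(\<lambda>\<xi>. flip F \<xi> k) \<in> Rad \<rightarrow>\<^sub>M count_space UNIV" for k
    unfolding flip_def by (rule measurable_compose[OF measurable_Rad_component_discrete]) simp
qed

lemma distr_flip: "distr Rad Rad (flip F) = Rad"
proof -
  have "distr sign_measure sign_measure (\<lambda>x. if k \<in> F then - x else x) = sign_measure" for k
    using distr_sign_measure_uminus by (cases "k \<in> F") simp_all
  from Rad_product.distr_PiM_componentwise[of "\<lambda>k x. if k \<in> F then - x else x", OF _ this]
  show ?thesis
    by (simp add: Rad_def restrict_UNIV flip_def[abs_def])
qed

lemma distr_Rad_shift: "distr Rad Rad (\<lambda>\<xi> k. \<xi> (Suc k)) = Rad"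
  using distr_PiM_reindex[of UNIV "\<lambda>_. sign_measure" Suc UNIV]
  by (simp add: Rad_def restrict_UNIV measure_pmf.prob_space_axioms)

lemma AE_Rad_square: "AE \<xi> in Rad. (\<xi> k)\<^sup>2 = 1"
  using AE_Rad_sign by eventually_elim (metis insertE power2_minus power_one singletonD)

interpretation Rad: indep_centered_sequence Rad "\<lambda>k \<xi>. \<xi> k"
proof unfold_locales
  show "Rad.indep_vars (\<lambda>_. borel) (\<lambda>k \<xi>. \<xi> k) UNIV"
    using Rad_product.P.indep_vars_compose2[OF Rad_product.indep_vars_component,
        of "\<lambda>_ x. x" "\<lambda>_. borel"]
    by (simp add: Rad_def)
  show "integrable Rad (\<lambda>\<xi>. (\<xi> k)\<^sup>2)" for k
    using AE_Rad_square[of k] by (intro Rad.integrable_const_bound[of _ 1]) auto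
  have "Rad.expectation (\<lambda>\<xi>. \<xi> k) = (\<integral>x. x \<partial>sign_measure)" for k
    by (subst distr_Rad_component[of k, symmetric], subst integral_distr)
      (simp_all add: measurable_Rad_component_discrete)
  then show "Rad.expectation (\<lambda>\<xi>. \<xi> k) = 0" for k
    by (simp add: integral_pmf_of_set)
qed

lemma Rad_expectation_square: "Rad.expectation (\<lambda>\<xi>. (c * \<xi> k)\<^sup>2) = c\<^sup>2"
proof -
  have "Rad.expectation (\<lambda>\<xi>. (c * \<xi> k)\<^sup>2) = Rad.expectation (\<lambda>_. c\<^sup>2)"
    using AE_Rad_square[of k] by (intro integral_cong_AE) (auto simp: power_mult_distrib)
  then show ?thesis by (simp add: Rad.prob_space)
qed

lemma AE_Rad_summable:
  assumes "summable (\<lambda>k. (c k)\<^sup>2)"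
  shows "AE \<xi> in Rad. summable (\<lambda>k. c k * \<xi> k)"
proof -
  interpret scaled: indep_centered_sequence Rad "\<lambda>k \<xi>. c k * \<xi> k"
    by (rule Rad.indep_centered_sequence_scale)
  show ?thesis
    using assms by (intro scaled.AE_summable) (simp add: Rad_expectation_square)
qed

lemma Rad_Chebyshev:
  assumes "0 < e"
  shows "Rad.prob {\<xi>\<in>space Rad. e \<le> \<bar>\<Sum>k<n. c k * \<xi> k\<bar>} \<le> (\<Sum>k<n. (c k)\<^sup>2) / e\<^sup>2"
proof -
  interpret scaled: indep_centered_sequence Rad "\<lambda>k \<xi>. c k * \<xi> k"
    by (rule Rad.indep_centered_sequence_scale)
  have "Rad.prob {\<xi>\<in>space Rad. e \<le> \<bar>\<Sum>k<n. c k * \<xi> k\<bar>}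
      \<le> Rad.prob {\<xi>\<in>space Rad. \<exists>m\<le>n. e \<le> \<bar>\<Sum>k<m. c k * \<xi> k\<bar>}"
    by (rule Rad.finite_measure_mono) auto
  also have "\<dots> \<le> (\<Sum>k<n. (c k)\<^sup>2) / e\<^sup>2"
    using scaled.Kolmogorov_maximal_inequality[OF assms, of n] by (simp add: Rad_expectation_square)
  finally show ?thesis .
qed

lemma Rad_weighted_sum_tendsto_in_prob:
  fixes w :: "nat \<Rightarrow> nat \<Rightarrow> real"
  assumes "summable (\<lambda>k. (c k)\<^sup>2)" and lim: "(\<lambda>n. \<Sum>k<n. (w n k - c k)\<^sup>2) \<longlonglongrightarrow> 0"
  shows "Rad.tendsto_in_prob (\<lambda>n \<xi>. \<Sum>k<n. w n k * \<xi> k) (\<lambda>\<xi>. \<Sum>k. c k * \<xi> k) sequentially"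
proof -
  have "Rad.tendsto_in_prob (\<lambda>n \<xi>. \<Sum>k<n. (w n k - c k) * \<xi> k) (\<lambda>_. 0) sequentially"
    unfolding Rad.tendsto_in_prob_def
  proof (intro allI impI, rule tendsto_sandwich[OF _ _ tendsto_const])
    fix e :: real assume "0 < e"
    show "(\<lambda>n. (\<Sum>k<n. (w n k - c k)\<^sup>2) / e\<^sup>2) \<longlonglongrightarrow> 0"
      by (rule tendsto_divide_zero[OF lim])
    show "\<forall>\<^sub>F n in sequentially. Rad.prob {\<xi>\<in>space Rad. e \<le> norm ((\<Sum>k<n. (w n k - c k) * \<xi> k) - 0)}
        \<le> (\<Sum>k<n. (w n k - c k)\<^sup>2) / e\<^sup>2"
      using Rad_Chebyshev[OF \<open>0 < e\<close>] by simp
  qed simp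
  moreover have "Rad.tendsto_in_prob (\<lambda>n \<xi>. \<Sum>k<n. c k * \<xi> k) (\<lambda>\<xi>. \<Sum>k. c k * \<xi> k) sequentially"
    using AE_Rad_summable[OF assms(1)]
    by (intro Rad.tendsto_in_prob_AE) (auto elim: eventually_mono dest: summable_LIMSEQ)
  ultimately have "Rad.tendsto_in_prob
      (\<lambda>n \<xi>. (\<Sum>k<n. (w n k - c k) * \<xi> k) + (\<Sum>k<n. c k * \<xi> k))
      (\<lambda>\<xi>. 0 + (\<Sum>k. c k * \<xi> k)) sequentially"
    by (intro Rad.tendsto_in_prob_add) simp_all
  then show ?thesis
    by (simp add: left_diff_distrib sum_subtractf)
qed

lemma sums_flip:
  assumes "finite F" "summable (\<lambda>k. c k * \<xi> k)"
  shows "(\<lambda>k. c k * flip F \<xi> k) sums ((\<Sum>k. c k * \<xi> k) - 2 * (\<Sum>k\<in>F. c k * \<xi> k))"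
proof -
  have "(\<lambda>k. c k * \<xi> k - 2 * (if k \<in> F then c k * \<xi> k else 0))
      sums ((\<Sum>k. c k * \<xi> k) - 2 * (\<Sum>k\<in>F. c k * \<xi> k))"
    using assms by (intro sums_diff sums_mult summable_sums sums_If_finite_set)
  also have "(\<lambda>k. c k * \<xi> k - 2 * (if k \<in> F then c k * \<xi> k else 0)) = (\<lambda>k. c k * flip F \<xi> k)"
    by (auto simp: flip_def)
  finally show ?thesis .
qed

lemma (in prob_space) prob_eq_0_if_AE_disjoint_copies:
  assumes "infinite K" and A: "\<And>j. A j \<in> events" "\<And>j. prob (A j) = p"
    and disjoint: "\<And>i j. i \<in> K \<Longrightarrow> j \<in> K \<Longrightarrow> i \<noteq> j \<Longrightarrow> AE \<omega> in M. \<omega> \<notin> A i \<or> \<omega> \<notin> A j"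
  shows "p = 0"
proof (rule ccontr)
  assume "p \<noteq> 0"
  then have "0 < p" using A(2) measure_nonneg[of M] by (metis order_le_less)
  then obtain n where "1 < real n * p" using reals_Archimedean3 by blast
  obtain F where F: "finite F" "card F = n" "F \<subseteq> K"
    using infinite_arbitrarily_large[OF \<open>infinite K\<close>] by blast
  then have "pairwise (\<lambda>i j. AE \<omega> in M. \<omega> \<notin> A i \<or> \<omega> \<notin> A j) F"
    using disjoint unfolding pairwise_def by blast
  then have "prob (\<Union>j\<in>F. A j) = (\<Sum>j\<in>F. prob (A j))"
    using F A(1) by (intro measure_UNION_AE) (auto simp: fmeasurable_eq_sets)
  then have "real n * p = prob (\<Union>j\<in>F. A j)" using F A(2) by simp
  also have "\<dots> \<le> 1" by (rule prob_le_1)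
  finally show False using \<open>1 < real n * p\<close> by simp
qed

text \<open>Flipping the \<open>j\<close>-th sign moves the sum by \<open>2 \<bar>c j\<bar>\<close>. Flips at indices with distinct \<open>\<bar>c j\<bar>\<close>
  therefore carry an atom to almost surely disjoint events of equal probability.\<close>

lemma Rad_series_no_atom:
  assumes summable: "summable (\<lambda>k. (c k)\<^sup>2)" and infinite: "infinite (range (\<lambda>k. \<bar>c k\<bar>))"
  shows "Rad.prob {\<xi>\<in>space Rad. (\<Sum>k. c k * \<xi> k) = x} = 0"
proof -
  define A where "A j = {\<xi>\<in>space Rad. (\<Sum>k. c k * flip {j} \<xi> k) = x}" for j
  obtain K where K: "inj_on (\<lambda>k. \<bar>c k\<bar>) K" "range (\<lambda>k. \<bar>c k\<bar>) = (\<lambda>k. \<bar>c k\<bar>) ` K"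
    using subset_image_inj[of "range (\<lambda>k. \<bar>c k\<bar>)" "\<lambda>k. \<bar>c k\<bar>" UNIV] by auto
  have "infinite K" using K infinite by auto
  then show ?thesis
  proof (rule Rad.prob_eq_0_if_AE_disjoint_copies)
    show "A j \<in> sets Rad" for j
      unfolding A_def by measurable
    show "Rad.prob (A j) = Rad.prob {\<xi>\<in>space Rad. (\<Sum>k. c k * \<xi> k) = x}" for j
      unfolding A_def
      by (rule measure_Collect_invariant[OF measurable_flip _ distr_flip]) measurable
    show "AE \<xi> in Rad. \<xi> \<notin> A i \<or> \<xi> \<notin> A j" if "i \<in> K" "j \<in> K" "i \<noteq> j" for i j
      using AE_Rad_sign AE_Rad_summable[OF summable]
    proof eventually_elim
      case (elim \<xi>)
      have "\<bar>\<xi> i\<bar> = 1" "\<bar>\<xi> j\<bar> = 1"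
        using elim(1)[rule_format, of i] elim(1)[rule_format, of j] by auto
      then have "\<bar>c i * \<xi> i\<bar> \<noteq> \<bar>c j * \<xi> j\<bar>"
        using K(1) that by (auto simp: abs_mult inj_on_def)
      then have "(\<Sum>k. c k * flip {i} \<xi> k) \<noteq> (\<Sum>k. c k * flip {j} \<xi> k)"
        using sums_flip[OF _ elim(2), of "{i}"] sums_flip[OF _ elim(2), of "{j}"]
        by (auto simp: sums_iff)
      then show ?case by (auto simp: A_def)
    qed
  qed
qed

text \<open>On the event that the first \<open>n\<close> signs are \<open>1\<close>, flipping all later signs reflects the sum at
  \<open>\<Sum>k<n. c k\<close>, so it is at least this value with conditional probability at least \<open>1/2\<close>.\<close>

lemma Rad_series_exceeds:
  assumes summable: "summable (\<lambda>k. (c k)\<^sup>2)" and "t < (\<Sum>k<n. c k)"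
  shows "0 < Rad.prob {\<xi>\<in>space Rad. t < (\<Sum>k. c k * \<xi> k)}"
proof -
  define upper where "upper \<xi> \<longleftrightarrow> t < (\<Sum>k. c k * \<xi> k)" for \<xi>
  have [measurable]: "Measurable.pred Rad upper" unfolding upper_def by measurable
  let ?upper = "{\<xi>\<in>space Rad. upper \<xi>}" and ?reflected = "{\<xi>\<in>space Rad. upper (flip (- {..<n}) \<xi>)}"
  have "AE \<xi> in Rad. (\<forall>k<n. \<xi> k = 1) \<longrightarrow> upper \<xi> \<or> upper (flip (- {..<n}) \<xi>)"
    using AE_Rad_summable[OF summable]
  proof eventually_elim
    case (elim \<xi>)
    show ?case
    proof
      assume "\<forall>k<n. \<xi> k = 1"
      then have "(\<Sum>k<n. c k * \<xi> k) = (\<Sum>k<n. c k)" by simp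
      moreover have "flip (- {..<n}) \<xi> k = - flip {..<n} \<xi> k" for k
        by (simp add: flip_def)
      ultimately have "(\<Sum>k. c k * flip (- {..<n}) \<xi> k) = 2 * (\<Sum>k<n. c k) - (\<Sum>k. c k * \<xi> k)"
        using sums_minus[OF sums_flip[OF _ elim, of "{..<n}"]] by (simp add: sums_iff)
      then show "upper \<xi> \<or> upper (flip (- {..<n}) \<xi>)"
        using \<open>t < (\<Sum>k<n. c k)\<close> unfolding upper_def by linarith
    qed
  qed
  then have "Rad.prob {\<xi>\<in>space Rad. \<forall>k\<in>{..<n}. \<xi> k = 1} \<le> Rad.prob (?upper \<union> ?reflected)"
    by (intro Rad.finite_measure_mono_AE) (auto elim!: eventually_mono)
  also have "\<dots> \<le> Rad.prob ?upper + Rad.prob ?reflected"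
    by (rule measure_Un_le) measurable
  also have "Rad.prob ?reflected = Rad.prob ?upper"
    by (rule measure_Collect_invariant[OF measurable_flip _ distr_flip]) measurable
  finally have "(1/2) ^ n \<le> 2 * Rad.prob ?upper"
    by (simp add: Rad_cylinder)
  moreover have "0 < (1/2 :: real) ^ n" by simp
  ultimately show ?thesis unfolding upper_def by linarith
qed

lemma Rad_series_threshold_limit:
  fixes w :: "nat \<Rightarrow> nat \<Rightarrow> real"
  assumes summable: "summable (\<lambda>k. (c k)\<^sup>2)" and infinite: "infinite (range (\<lambda>k. \<bar>c k\<bar>))"
    and weights: "(\<lambda>n. \<Sum>k<n. (w n k - c k)\<^sup>2) \<longlonglongrightarrow> 0"
    and thresholds: "g \<longlonglongrightarrow> g'" and drifts: "\<epsilon> \<longlonglongrightarrow> 0"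
  shows "(\<lambda>n. Rad.prob {\<xi>\<in>space Rad. g n \<le> \<bar>(\<Sum>k<n. w n k * \<xi> k) + \<epsilon> n\<bar>})
    \<longlonglongrightarrow> Rad.prob {\<xi>\<in>space Rad. g' < \<bar>\<Sum>k. c k * \<xi> k\<bar>}"
proof -
  let ?Y = "\<lambda>\<xi>. \<Sum>k. c k * \<xi> k"
  have "Rad.tendsto_in_prob (\<lambda>n \<xi>. (\<Sum>k<n. w n k * \<xi> k) + \<epsilon> n) (\<lambda>\<xi>. ?Y \<xi> + 0) sequentially"
    using Rad_weighted_sum_tendsto_in_prob[OF summable weights] Rad.tendsto_in_prob_const[OF drifts]
    by (intro Rad.tendsto_in_prob_add) simp_all
  then have "Rad.tendsto_in_prob
      (\<lambda>n \<xi>. norm ((\<Sum>k<n. w n k * \<xi> k) + \<epsilon> n)) (\<lambda>\<xi>. norm (?Y \<xi> + 0)) sequentially"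
    by (rule Rad.tendsto_in_prob_norm[rotated 2]) simp_all
  then have "Rad.tendsto_in_prob (\<lambda>n \<xi>. norm ((\<Sum>k<n. w n k * \<xi> k) + \<epsilon> n) + (- g n))
      (\<lambda>\<xi>. norm (?Y \<xi> + 0) + (- g')) sequentially"
    using Rad.tendsto_in_prob_const[OF tendsto_minus[OF thresholds]]
    by (intro Rad.tendsto_in_prob_add) simp_all
  moreover have "Rad.prob {\<xi>\<in>space Rad. norm (?Y \<xi> + 0) + (- g') = 0} = 0"
  proof -
    have "Rad.prob {\<xi>\<in>space Rad. norm (?Y \<xi> + 0) + (- g') = 0}
        \<le> Rad.prob ({\<xi>\<in>space Rad. ?Y \<xi> = g'} \<union> {\<xi>\<in>space Rad. ?Y \<xi> = - g'})"
      by (rule Rad.finite_measure_mono) auto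
    also have "\<dots> \<le> Rad.prob {\<xi>\<in>space Rad. ?Y \<xi> = g'} + Rad.prob {\<xi>\<in>space Rad. ?Y \<xi> = - g'}"
      by (rule measure_Un_le) measurable
    also have "\<dots> = 0" by (simp add: Rad_series_no_atom[OF summable infinite])
    finally show ?thesis by (simp add: measure_le_0_iff)
  qed
  ultimately have "(\<lambda>n. Rad.prob {\<xi>\<in>space Rad. 0 \<le> norm ((\<Sum>k<n. w n k * \<xi> k) + \<epsilon> n) + (- g n)})
      \<longlonglongrightarrow> Rad.prob {\<xi>\<in>space Rad. 0 < norm (?Y \<xi> + 0) + (- g')}"
    by (intro Rad.prob_nonneg_tendsto) simp_all
  then show ?thesis by simp
qed

section \<open>The binary tree\<close>

lemma mem_An_iff:
  "xs \<in> An H \<sigma> a N n \<longleftrightarrow>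
    set xs \<subseteq> {-1, 1} \<and> length xs = n - 1 \<and> gn H \<sigma> N n \<le> \<bar>Yn H \<sigma> N n xs + an a N n\<bar>"
  by (auto simp: An_def un_def dn_def)

lemma Yn_rev_eq_weight:
  assumes "1/2 < H" "H < 1" "0 < N"
  shows "Yn H \<sigma> N (Suc n) (map \<xi> (rev [0..<n]))
    = 2 * gH H \<sigma> * real N powr (- H) * (\<Sum>k<n. weight H (Suc n) (n - k) * \<xi> k)"
proof -
  have "Yn H \<sigma> N (Suc n) (map \<xi> (rev [0..<n])) = (\<Sum>i=1..n. Jn H \<sigma> N (Suc n) i * \<xi> (n - i))"
    unfolding Yn_def by (intro sum.cong) (auto simp: rev_nth)
  also have "\<dots> = (\<Sum>k<n. Jn H \<sigma> N (Suc n) (n - k) * \<xi> k)"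
    by (rule sum.reindex_bij_witness[of _ "\<lambda>k. n - k" "\<lambda>i. n - i"]) auto
  also have "\<dots> = 2 * gH H \<sigma> * real N powr (- H) * (\<Sum>k<n. weight H (Suc n) (n - k) * \<xi> k)"
    by (simp add: Jn_eq_weight[OF assms] sum_distrib_left mult_ac)
  finally show ?thesis .
qed

lemma map_rev_mem_An_iff:
  assumes H: "1/2 < H" "H < 1" and "0 < \<sigma>" "0 < N" and signs: "\<forall>k. \<xi> k \<in> {-1, 1}"
  shows "map \<xi> (rev [0..<n]) \<in> An H \<sigma> a N (Suc n) \<longleftrightarrow> weight H (Suc n) (Suc n)
    \<le> \<bar>(\<Sum>k<n. weight H (Suc n) (n - k) * \<xi> k) + real N powr H * an a N (Suc n) / (2 * gH H \<sigma>)\<bar>"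
proof -
  let ?xs = "map \<xi> (rev [0..<n])" and ?Y = "\<Sum>k<n. weight H (Suc n) (n - k) * \<xi> k"
  define scale where "scale = 2 * gH H \<sigma> * real N powr (- H)"
  define drift where "drift = real N powr H * an a N (Suc n) / (2 * gH H \<sigma>)"
  have "0 < scale"
    using gH_pos[OF H \<open>0 < \<sigma>\<close>] \<open>0 < N\<close> by (simp add: scale_def)
  have scaled: "Yn H \<sigma> N (Suc n) ?xs = scale * ?Y"
    "gn H \<sigma> N (Suc n) = scale * weight H (Suc n) (Suc n)" "an a N (Suc n) = scale * drift"
    using Yn_rev_eq_weight[OF H] gn_eq_Jn[of "Suc n" N] Jn_eq_weight[OF H]
      gH_pos[OF H \<open>0 < \<sigma>\<close>] \<open>0 < N\<close>
    by (simp_all add: scale_def drift_def powr_minus)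
  have "set ?xs \<subseteq> {-1, 1}" using signs by auto
  then have "?xs \<in> An H \<sigma> a N (Suc n) \<longleftrightarrow>
      gn H \<sigma> N (Suc n) \<le> \<bar>Yn H \<sigma> N (Suc n) ?xs + an a N (Suc n)\<bar>"
    by (simp add: mem_An_iff)
  also have "\<dots> \<longleftrightarrow> scale * weight H (Suc n) (Suc n) \<le> \<bar>scale * (?Y + drift)\<bar>"
    by (simp only: scaled distrib_left)
  finally show ?thesis
    using \<open>0 < scale\<close> by (simp add: abs_mult drift_def)
qed

lemma An_density_eq_prob:
  assumes "1/2 < H" "H < 1" "0 < \<sigma>" "0 < N"
  shows "real (card (An H \<sigma> a N (Suc n))) / 2 ^ n = Rad.prob {\<xi>\<in>space Rad. weight H (Suc n) (Suc n)
    \<le> \<bar>(\<Sum>k<n. weight H (Suc n) (n - k) * \<xi> k) + real N powr H * an a N (Suc n) / (2 * gH H \<sigma>)\<bar>}"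
    (is "_ = Rad.prob ?event")
proof -
  let ?in_An = "{\<xi>\<in>space Rad. map \<xi> (rev [0..<n]) \<in> An H \<sigma> a N (Suc n)}"
  have An: "An H \<sigma> a N (Suc n) \<subseteq> {xs. set xs \<subseteq> {-1, 1} \<and> length xs = length (rev [0..<n])}"
    by (auto simp: mem_An_iff)
  have "real (card (An H \<sigma> a N (Suc n))) / 2 ^ n = Rad.prob ?in_An"
    using Rad_prob_map_mem(1)[OF _ An] by simp
  also have "\<dots> = Rad.prob ?event"
  proof (rule Rad.finite_measure_eq_AE)
    show "AE \<xi> in Rad. \<xi> \<in> ?in_An \<longleftrightarrow> \<xi> \<in> ?event"
      using AE_Rad_sign by eventually_elim (use map_rev_mem_An_iff[OF assms] in blast)
    show "?in_An \<in> sets Rad"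
      by (rule Rad_prob_map_mem(2)[OF _ An]) simp
    show "?event \<in> sets Rad" by measurable
  qed
  finally show ?thesis .
qed

lemma prob_YH_eq:
  assumes "1/2 < H" "H < 1" "0 < \<sigma>"
  shows "measure Rad {\<xi>\<in>space Rad. \<bar>YH H \<sigma> \<xi>\<bar> > gH H \<sigma>}
    = Rad.prob {\<xi>\<in>space Rad. 1/2 < \<bar>\<Sum>k. limit_weight H (Suc k) * \<xi> k\<bar>}"
proof -
  have "gH H \<sigma> < \<bar>YH H \<sigma> \<xi>\<bar> \<longleftrightarrow> 1/2 < \<bar>\<Sum>k. limit_weight H (Suc k) * \<xi> (Suc k)\<bar>" for \<xi>
    using gH_pos[OF assms] by (simp add: YH_def limit_weight_def abs_mult field_simps)
  moreover have "(\<lambda>\<xi> k. \<xi> (Suc k)) \<in> Rad \<rightarrow>\<^sub>M Rad"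
    by (rule measurable_into_Rad) measurable
  ultimately show ?thesis
    using measure_Collect_invariant[OF _ _ distr_Rad_shift,
        of "\<lambda>\<xi>. 1/2 < \<bar>\<Sum>k. limit_weight H (Suc k) * \<xi> k\<bar>"]
    by simp
qed

lemma drift_tendsto_0:
  assumes "H < 1" "continuous_on {0..1} a" "\<And>n. n \<le> Nseq n"
  shows "(\<lambda>n. real (Nseq n) powr H * an a (Nseq n) n) \<longlonglongrightarrow> 0"
proof -
  obtain B where "\<forall>x\<in>a ` {0..1}. norm x \<le> B"
    using compact_imp_bounded[OF compact_continuous_image[OF assms(2) compact_Icc]]
    unfolding bounded_iff by blast
  then have B: "\<bar>a t\<bar> \<le> B" if "t \<in> {0..1}" for t using that by simp
  have "\<forall>\<^sub>F n in sequentially.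
      norm (real (Nseq n) powr H * an a (Nseq n) n) \<le> B * real n powr (H - 1)"
    using eventually_ge_at_top[of 1]
  proof eventually_elim
    case (elim n)
    have Nseq: "0 < real (Nseq n)" "real n \<le> real (Nseq n)" using elim assms(3)[of n] by auto
    have "norm (real (Nseq n) powr H * an a (Nseq n) n)
        = \<bar>a (real n / real (Nseq n))\<bar> * real (Nseq n) powr (H - 1)"
      using Nseq by (simp add: an_def abs_mult powr_diff)
    also have "\<dots> \<le> B * real n powr (H - 1)"
      using Nseq elim assms(1) B[of "real n / real (Nseq n)"]
      by (intro mult_mono powr_mono2') (auto intro: order_trans[OF abs_ge_zero B[of 0]])
    finally show ?case .
  qed
  moreover have "(\<lambda>n. B * real n powr (H - 1)) \<longlonglongrightarrow> 0"
    using assms(1) by real_asymp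
  ultimately show ?thesis
    by (rule Lim_null_comparison)
qed

lemma An_density_tendsto:
  assumes H: "1/2 < H" "H < 1" and "0 < \<sigma>" "continuous_on {0..1} a" "\<And>n. n \<le> Nseq n"
  shows "(\<lambda>n. real (card (An H \<sigma> a (Nseq n) n)) / 2 ^ (n - 1))
    \<longlonglongrightarrow> measure Rad {\<xi>\<in>space Rad. \<bar>YH H \<sigma> \<xi>\<bar> > gH H \<sigma>}"
proof (rule LIMSEQ_imp_Suc)
  define drift where
    "drift n = real (Nseq (Suc n)) powr H * an a (Nseq (Suc n)) (Suc n) / (2 * gH H \<sigma>)" for n
  have "drift \<longlonglongrightarrow> 0"
    unfolding drift_def
    by (intro tendsto_divide_zero LIMSEQ_Suc[OF drift_tendsto_0] assms)
  then have "(\<lambda>n. Rad.prob {\<xi>\<in>space Rad. weight H (Suc n) (Suc n)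
      \<le> \<bar>(\<Sum>k<n. weight H (Suc n) (n - k) * \<xi> k) + drift n\<bar>})
    \<longlonglongrightarrow> Rad.prob {\<xi>\<in>space Rad. 1/2 < \<bar>\<Sum>k. limit_weight H (Suc k) * \<xi> k\<bar>}"
    by (intro Rad_series_threshold_limit summable_limit_weight_square infinite_range_limit_weight
        weight_row_tendsto weight_diagonal_tendsto H)
  moreover have Nseq_pos: "0 < Nseq (Suc n)" for n
    using assms(5)[of "Suc n"] by simp
  ultimately show "(\<lambda>n. real (card (An H \<sigma> a (Nseq (Suc n)) (Suc n))) / 2 ^ (Suc n - 1))
      \<longlonglongrightarrow> measure Rad {\<xi>\<in>space Rad. \<bar>YH H \<sigma> \<xi>\<bar> > gH H \<sigma>}"
    by (simp only: prob_YH_eq[OF assms(1-3)] An_density_eq_prob[OF assms(1-3) Nseq_pos]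
        drift_def diff_Suc_1)
qed

lemma prob_YH_exceeds_pos:
  assumes "1/2 < H" "H < 1" "0 < \<sigma>"
  shows "0 < measure Rad {\<xi>\<in>space Rad. \<bar>YH H \<sigma> \<xi>\<bar> > gH H \<sigma>}"
proof -
  let ?Y = "\<lambda>\<xi>. \<Sum>k. limit_weight H (Suc k) * \<xi> k"
  obtain n where "1/2 < (\<Sum>k<n. limit_weight H (Suc k))"
    using sum_limit_weight_exceeds assms by blast
  with summable_limit_weight_square have "0 < Rad.prob {\<xi>\<in>space Rad. 1/2 < ?Y \<xi>}"
    using assms by (intro Rad_series_exceeds)
  also have "\<dots> \<le> Rad.prob {\<xi>\<in>space Rad. 1/2 < \<bar>?Y \<xi>\<bar>}"
    by (rule Rad.finite_measure_mono) auto
  finally show ?thesis unfolding prob_YH_eq[OF assms] .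
qed

lemma card_An_le: "card (An H \<sigma> a N n) \<le> 2 ^ (n - 1)"
proof -
  have "card (An H \<sigma> a N n) \<le> card {xs :: real list. set xs \<subseteq> {-1, 1} \<and> length xs = n - 1}"
    by (intro card_mono finite_lists_length_eq) (auto simp: mem_An_iff)
  then show ?thesis
    by (simp add: card_lists_length_eq numeral_2_eq_2)
qed

lemma card_Aset: "card (Aset H \<sigma> a N) = (\<Sum>n=1..N. card (An H \<sigma> a N n))"
  unfolding Aset_def
proof (rule card_UN_disjoint)
  show "\<forall>n\<in>{1..N}. finite (An H \<sigma> a N n)"
    by (intro ballI finite_subset[OF _ finite_lists_length_eq[of "{-1, 1}"]])
      (auto simp: mem_An_iff)
qed (auto simp: mem_An_iff)

lemma dyadic_sum_reverse:
  fixes q :: "nat \<Rightarrow> real"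
  shows "(\<Sum>n=1..N. 2 ^ (n - 1) * q n) / 2 ^ N = (\<Sum>j<N. q (N - j) * (1/2) ^ Suc j)"
proof -
  have "(\<Sum>n=1..N. 2 ^ (n - 1) * q n) / 2 ^ N = (\<Sum>n=1..N. q n * (1/2) ^ Suc (N - n))"
    unfolding sum_divide_distrib
  proof (rule sum.cong[OF refl])
    fix n assume "n \<in> {1..N}"
    then have "N = Suc (N - n) + (n - 1)" by auto
    then have "(2::real) ^ N = 2 ^ Suc (N - n) * 2 ^ (n - 1)" by (metis power_add)
    then show "2 ^ (n - 1) * q n / 2 ^ N = q n * (1/2) ^ Suc (N - n)"
      by (simp add: power_one_over field_simps)
  qed
  also have "\<dots> = (\<Sum>j<N. q (N - j) * (1/2) ^ Suc j)"
    by (rule sum.reindex_bij_witness[of _ "\<lambda>j. N - j" "\<lambda>n. N - n"]) auto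
  finally show ?thesis .
qed

lemma dyadic_average_tendsto:
  fixes q :: "nat \<Rightarrow> nat \<Rightarrow> real"
  assumes lim: "\<And>j. (\<lambda>n. q (n + j) n) \<longlonglongrightarrow> L" and bound: "\<And>N n. \<bar>q N n\<bar> \<le> B"
  shows "(\<lambda>N. (\<Sum>n=1..N. 2 ^ (n - 1) * q N n) / (2 ^ N - 1)) \<longlonglongrightarrow> L"
proof -
  define a where "a j N = (if j < N then q N (N - j) * (1/2) ^ Suc j else 0)" for j N
  have average: "(\<Sum>n=1..N. 2 ^ (n - 1) * q N n) / 2 ^ N = (\<Sum>j. a j N)" for N
    unfolding dyadic_sum_reverse by (subst suminf_finite[of "{..<N}"]) (auto simp: a_def)
  have "(\<lambda>N. \<Sum>j. a j N) \<longlonglongrightarrow> (\<Sum>j. L * (1/2) ^ Suc j)"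
  proof (rule tannerys_theorem[THEN conjunct2, THEN conjunct2])
    show "a j \<longlonglongrightarrow> L * (1/2) ^ Suc j" for j
    proof (rule LIMSEQ_offset[of _ j], rule Lim_transform_eventually)
      show "(\<lambda>n. q (n + j) n * (1/2) ^ Suc j) \<longlonglongrightarrow> L * (1/2) ^ Suc j"
        by (intro tendsto_mult_right lim)
      show "\<forall>\<^sub>F n in sequentially. q (n + j) n * (1/2) ^ Suc j = a j (n + j)"
        using eventually_gt_at_top[of 0] by eventually_elim (simp add: a_def)
    qed
    have "norm (a j N) \<le> B * (1/2) ^ Suc j" for j N
      using bound[of N "N - j"] bound[of 0 0] by (auto simp: a_def abs_mult intro!: mult_right_mono)
    then show "\<forall>\<^sub>F (j, N) in at_top \<times>\<^sub>F sequentially. norm (a j N) \<le> B * (1/2) ^ Suc j"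
      by (simp add: case_prod_unfold)
    show "summable (\<lambda>j. B * (1/2) ^ Suc j)"
      by (intro summable_mult sums_summable[OF power_half_series])
  qed simp
  also have "(\<Sum>j. L * (1/2) ^ Suc j) = L"
    using sums_mult[OF power_half_series, of L] by (simp add: sums_iff)
  finally have "(\<lambda>N. (\<Sum>j. a j N) * (2 ^ N / (2 ^ N - 1))) \<longlonglongrightarrow> L * 1"
    by (rule tendsto_mult) real_asymp
  then show ?thesis by (simp flip: average)
qed

theorem theorem3p3:
  fixes H \<sigma> :: real and a :: "real \<Rightarrow> real" and Nseq :: "nat \<Rightarrow> nat"
  assumes "1/2 < H" "H < 1" "\<sigma> > 0" "continuous_on {0..1} a"
    and "\<forall>n. Nseq n \<ge> n"
  shows "(\<lambda>n. real (card (An H \<sigma> a (Nseq n) n)) / 2 ^ (n - 1))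
           \<longlonglongrightarrow> measure Rad {\<xi> \<in> space Rad. \<bar>YH H \<sigma> \<xi>\<bar> > gH H \<sigma>}
      \<and> measure Rad {\<xi> \<in> space Rad. \<bar>YH H \<sigma> \<xi>\<bar> > gH H \<sigma>} > 0
      \<and> (\<lambda>N. real (card (Aset H \<sigma> a N)) / (2 ^ N - 1))
           \<longlonglongrightarrow> measure Rad {\<xi> \<in> space Rad. \<bar>YH H \<sigma> \<xi>\<bar> > gH H \<sigma>}"
proof (intro conjI)
  let ?P = "measure Rad {\<xi> \<in> space Rad. \<bar>YH H \<sigma> \<xi>\<bar> > gH H \<sigma>}"
  let ?density = "\<lambda>N n. real (card (An H \<sigma> a N n)) / 2 ^ (n - 1)"
  note density_tendsto = An_density_tendsto[OF assms(1-4)]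
  show "(\<lambda>n. ?density (Nseq n) n) \<longlonglongrightarrow> ?P"
    using assms(5) by (intro density_tendsto) simp
  show "?P > 0"
    by (rule prob_YH_exceeds_pos[OF assms(1-3)])
  have "(\<lambda>n. ?density (n + j) n) \<longlonglongrightarrow> ?P" for j
    by (rule density_tendsto) simp
  moreover have "real (card (An H \<sigma> a N n)) \<le> 2 ^ (n - 1)" for N n
    using card_An_le[of H \<sigma> a N n] by (simp flip: of_nat_le_iff)
  then have "\<bar>?density N n\<bar> \<le> 1" for N n
    by simp
  ultimately have "(\<lambda>N. (\<Sum>n=1..N. 2 ^ (n - 1) * ?density N n) / (2 ^ N - 1)) \<longlonglongrightarrow> ?P"
    by (rule dyadic_average_tendsto)
  then show "(\<lambda>N. real (card (Aset H \<sigma> a N)) / (2 ^ N - 1)) \<longlonglongrightarrow> ?P"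
    by (simp add: card_Aset)
qed

end
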